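(* Let $n\in\mathbb N$, let $\Phi\in\mathsf{CPTP}(n)$, and let $x,x^\perp\in\mathbb C^n$ be orthogonal unit vectors. Consider the following statements: (i) $\iota^\dagger\big((|x^\perp\rangle\langle x|)^T\otimes\mathbf 1\big)\,\mathsf C(\Phi)\,\big((|x^\perp\rangle\langle x|)^T\otimes\mathbf 1\big)^\dagger\iota=0$, where $\iota:\mathbb C^{n^2-\mathrm{rank}(\mathsf C(\Phi))}\to\ker(\mathsf C(\Phi))\subseteq\mathbb C^n\otimes\mathbb C^n$ is any unitary (onto $\ker(\mathsf C(\Phi))$). (ii) $\Phi(|x^\perp\rangle\langle x^\perp|)\,G\,|x\rangle=0$ for all $G\in\mathcal K_\Phi^\perp$. (iii) If $\{K_j\}_j$ is any set of Kraus operators of $\Phi$ and $\{G_k\}_k$ is any basis of $\mathcal K_\Phi^\perp$, then $\langle x^\perp|K_j^\dagger G_k|x\rangle=0$ for all $j,k$. Then (i), (ii) and (iii) are equivalent, and if $\Phi\Psi_{\lambda,x,x^\perp}^{-1}$ is completely positive for some $\lambda\in(0,1)$, then these equivalent statements hold.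
   Context: $\mathsf{CPTP}(n)$ denotes the set of completely positive, trace-preserving linear maps $\mathbb C^{n\times n}\to\mathbb C^{n\times n}$ (quantum channels). Products of maps denote composition. Inner products are linear in the second argument, $|u\rangle\langle v|=uv^\dagger$, and $(\cdot)^T$ is the transpose in the standard basis. Kraus operators of a completely positive map $\Phi$ are matrices $\{K_j\}_{j=1}^\ell\subset\mathbb C^{n\times n}$ (a finite family) with $\Phi(X)=\sum_j K_jXK_j^\dagger$ for all $X$. The Kraus subspace is $\mathcal K_\Phi:=\mathrm{span}\{K_1,\dots,K_\ell\}$; it does not depend on the choice of Kraus operators. $\mathcal K_\Phi^\perp$ is its orthogonal complement in $\mathbb C^{n\times n}$ with respect to $\langle A,B\rangle_{\rm HS}=\mathrm{tr}(A^\dagger B)$. The Choi matrix is $\mathsf C(\Phi)=\sum_{j,k=1}^n|j\rangle\langle k|\otimes\Phi(|j\rangle\langle k|)\in\mathbb C^{n\times n}\otimes\mathbb C^{n\times n}$, with $|j\rangle$ the standard basis. For linearly independent unit vectors $x,y\in\mathbb C^n$ and $\lambda\in[0,1]$ define $K_\lambda:=\mathbf 1-(1-\sqrt{1-\lambda})|x\rangle\langle x|$, $L_\lambda:=\sqrt\lambda\,|y\rangle\langle x|$ and the channel $\Psi_{\lambda,x,y}(\rho):=K_\lambda\rho K_\lambda^\dagger+L_\lambda\rho L_\lambda^\dagger$. For $\lambda\in[0,1)$ the linear map $\Psi_{\lambda,x,y}$ is bijective on $\mathbb C^{n\times n}$, and $\Psi_{\lambda,x,y}^{-1}$ denotes its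 inverse. *)

theory Defs
  imports
    "Jordan_Normal_Form.Schur_Decomposition"
    "Jordan_Normal_Form.Matrix_Kernel"
    "Jordan_Normal_Form.DL_Rank"
begin

abbreviation cmats :: "nat \<Rightarrow> (complex, complex mat) module" where
  "cmats n \<equiv> module_mat TYPE(complex) n n"

definition mat_trace :: "complex mat \<Rightarrow> complex" where
  "mat_trace A = (\<Sum>i<dim_row A. A $$ (i, i))"

(* |u><v| *)
definition outer :: "complex vec \<Rightarrow> complex vec \<Rightarrow> complex mat" where
  "outer u v = mat (dim_vec u) (dim_vec v) (\<lambda>(i, j). u $ i * cnj (v $ j))"

(* The library product "u \<bullet>c v" conjugates its second argument,
   so the physicists' <u|v> is "v \<bullet>c u". *)
definition braket :: "complex vec \<Rightarrow> complex vec \<Rightarrow> complex" where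
  "braket u v = v \<bullet>c u"

(* Tensor products are flattened with the left factor as the major index:
   |j> \<otimes> |a> in C^m \<otimes> C^n is the basis vector number j * n + a. *)
definition kron :: "complex mat \<Rightarrow> complex mat \<Rightarrow> complex mat" where
  "kron A B = mat (dim_row A * dim_row B) (dim_col A * dim_col B)
     (\<lambda>(i, j). A $$ (i div dim_row B, j div dim_col B) * B $$ (i mod dim_row B, j mod dim_col B))"

(* Over the complex numbers "0 \<le> z" includes that z is real, so this implies Hermitian. *)
definition psd :: "nat \<Rightarrow> complex mat \<Rightarrow> bool" where
  "psd n A \<longleftrightarrow> A \<in> carrier_mat n n \<and> (\<forall>v \<in> carrier_vec n. 0 \<le> braket v (A *\<^sub>v v))"

(* id_k \<otimes> \<Phi>: apply \<Phi> to each of the k * k blocks of size n of X. *)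
definition amplify :: "nat \<Rightarrow> nat \<Rightarrow> (complex mat \<Rightarrow> complex mat) \<Rightarrow> complex mat \<Rightarrow> complex mat" where
  "amplify k n \<Phi> X = mat (k * n) (k * n)
     (\<lambda>(i, j). \<Phi> (mat n n (\<lambda>(a, b). X $$ (i div n * n + a, j div n * n + b))) $$ (i mod n, j mod n))"

(* Maps on n x n matrices are total functions on the type of all matrices;
   only their values on carrier_mat n n matter. *)
definition completely_positive :: "nat \<Rightarrow> (complex mat \<Rightarrow> complex mat) \<Rightarrow> bool" where
  "completely_positive n \<Phi> \<longleftrightarrow>
     \<Phi> \<in> LinearCombinations.module_hom class_ring (cmats n) (cmats n) \<and>
     (\<forall>k X. psd (k * n) X \<longrightarrow> psd (k * n) (amplify k n \<Phi> X))"

definition CPTP :: "nat \<Rightarrow> (complex mat \<Rightarrow> complex mat) set" where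
  "CPTP n = {\<Phi>. completely_positive n \<Phi> \<and>
     (\<forall>X \<in> carrier_mat n n. mat_trace (\<Phi> X) = mat_trace X)}"

definition kraus_operators :: "nat \<Rightarrow> (complex mat \<Rightarrow> complex mat) \<Rightarrow> complex mat list \<Rightarrow> bool" where
  "kraus_operators n \<Phi> Ks \<longleftrightarrow> set Ks \<subseteq> carrier_mat n n \<and>
     (\<forall>X \<in> carrier_mat n n.
        \<Phi> X = finsum (cmats n) (\<lambda>j. Ks ! j * X * mat_adjoint (Ks ! j)) {..<length Ks})"

(* A completely positive map has Kraus operators, and their span is
   the same for every choice. *)
definition kraus_subspace :: "nat \<Rightarrow> (complex mat \<Rightarrow> complex mat) \<Rightarrow> complex mat set" where
  "kraus_subspace n \<Phi> =
     LinearCombinations.module.span class_ring (cmats n) (set (SOME Ks. kraus_operators n \<Phi> Ks))"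

definition kraus_perp :: "nat \<Rightarrow> (complex mat \<Rightarrow> complex mat) \<Rightarrow> complex mat set" where
  "kraus_perp n \<Phi> = {G \<in> carrier_mat n n.
     \<forall>K \<in> kraus_subspace n \<Phi>. mat_trace (mat_adjoint K * G) = 0}"

definition choi :: "nat \<Rightarrow> (complex mat \<Rightarrow> complex mat) \<Rightarrow> complex mat" where
  "choi n \<Phi> = finsum (cmats (n * n))
     (\<lambda>(j, k). kron (outer (unit_vec n j) (unit_vec n k)) (\<Phi> (outer (unit_vec n j) (unit_vec n k))))
     ({..<n} \<times> {..<n})"

definition Psi :: "nat \<Rightarrow> real \<Rightarrow> complex vec \<Rightarrow> complex vec \<Rightarrow> complex mat \<Rightarrow> complex mat" where
  "Psi n l x y \<rho> =
     (let K = 1\<^sub>m n - complex_of_real (1 - sqrt (1 - l)) \<cdot>\<^sub>m outer x x;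
          L = complex_of_real (sqrt l) \<cdot>\<^sub>m outer y x
      in K * \<rho> * mat_adjoint K + L * \<rho> * mat_adjoint L)"

definition kernel_dim :: "nat \<Rightarrow> (complex mat \<Rightarrow> complex mat) \<Rightarrow> nat" where
  "kernel_dim n \<Phi> = n * n - vec_space.rank (n * n) (choi n \<Phi>)"

(* \<iota> is the matrix of a unitary from C^kernel_dim onto the kernel of the Choi matrix. *)
definition kernel_unitary :: "nat \<Rightarrow> (complex mat \<Rightarrow> complex mat) \<Rightarrow> complex mat \<Rightarrow> bool" where
  "kernel_unitary n \<Phi> \<iota> \<longleftrightarrow>
     \<iota> \<in> carrier_mat (n * n) (kernel_dim n \<Phi>) \<and>
     mat_adjoint \<iota> * \<iota> = 1\<^sub>m (kernel_dim n \<Phi>) \<and>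
     (\<lambda>v. \<iota> *\<^sub>v v) ` carrier_vec (kernel_dim n \<Phi>) = mat_kernel (choi n \<Phi>)"

definition choi_condition ::
  "nat \<Rightarrow> (complex mat \<Rightarrow> complex mat) \<Rightarrow> complex vec \<Rightarrow> complex vec \<Rightarrow> complex mat \<Rightarrow> bool" where
  "choi_condition n \<Phi> x x' \<iota> \<longleftrightarrow>
     (let T = kron (transpose_mat (outer x' x)) (1\<^sub>m n)
      in mat_adjoint \<iota> * T * choi n \<Phi> * mat_adjoint T * \<iota> = 0\<^sub>m (kernel_dim n \<Phi>) (kernel_dim n \<Phi>))"

definition channel_condition ::
  "nat \<Rightarrow> (complex mat \<Rightarrow> complex mat) \<Rightarrow> complex vec \<Rightarrow> complex vec \<Rightarrow> bool" where
  "channel_condition n \<Phi> x x' \<longleftrightarrow>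
     (\<forall>G \<in> kraus_perp n \<Phi>. (\<Phi> (outer x' x') * G) *\<^sub>v x = 0\<^sub>v n)"

definition kraus_condition ::
  "nat \<Rightarrow> (complex mat \<Rightarrow> complex mat) \<Rightarrow> complex vec \<Rightarrow> complex vec \<Rightarrow> bool" where
  "kraus_condition n \<Phi> x x' \<longleftrightarrow>
     (\<forall>Ks Gs. kraus_operators n \<Phi> Ks \<and>
        vectorspace.basis class_ring ((cmats n)\<lparr>carrier := kraus_perp n \<Phi>\<rparr>) Gs \<longrightarrow>
        (\<forall>K \<in> set Ks. \<forall>G \<in> Gs. braket x' ((mat_adjoint K * G) *\<^sub>v x) = 0))"

end

theory Submission
  imports Defs
begin

text \<open>
  Let \<open>V\<close> be the matrix whose columns are the vectorized Kraus operators of \<open>\<Phi>\<close>. The Choi matrix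
  is \<open>V V\<^sup>\<dagger>\<close>, so vectorization identifies the orthogonal complement of the Kraus subspace with
  \<open>ker V\<^sup>\<dagger>\<close>, the kernel of the Choi matrix. All three conditions say that \<open><x'|K\<^sup>\<dagger> G|x> = 0\<close> for
  every Kraus operator \<open>K\<close> and every \<open>G\<close> in that complement: in (i) and (ii) these numbers are
  the entries of some \<open>W\<close> resp. \<open>W\<^sup>\<dagger> G|x>\<close>, and the conditions read \<open>W\<^sup>\<dagger> W = 0\<close> resp.
  \<open>W W\<^sup>\<dagger> G|x> = 0\<close>.

  If \<open>\<Lambda> = \<Phi> \<Psi>\<^sup>-\<^sup>1\<close> has Kraus operators \<open>M\<close>, then the \<open>M K\<^sub>\<lambda>\<close> and \<open>M L\<^sub>\<lambda>\<close> are Kraus operators of \<open>\<Phi>\<close>.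
  Since \<open>K\<^sub>\<lambda> x' = x'\<close> and \<open>L\<^sub>\<lambda> x' = 0\<close>, the conditions reduce to \<open><M x'|G x> = 0\<close>, which is the
  orthogonality of \<open>G\<close> to \<open>M L\<^sub>\<lambda>\<close>, a multiple of \<open>|M x'><x|\<close>.
\<close>

section \<open>Adjoints and vanishing of complex matrices\<close>

lemma dim_mat_adjoint [simp]:
  "dim_row (mat_adjoint A) = dim_col A" "dim_col (mat_adjoint A) = dim_row A"
  by (simp_all add: mat_adjoint_def)

lemma mat_adjoint_carrier [simp]:
  "A \<in> carrier_mat m n \<Longrightarrow> mat_adjoint A \<in> carrier_mat n m"
  by (auto intro!: carrier_matI)

lemma index_mat_adjoint [simp]:
  "i < dim_col A \<Longrightarrow> j < dim_row A \<Longrightarrow> mat_adjoint A $$ (i, j) = conjugate (A $$ (j, i))"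
  by (simp add: mat_adjoint_def mat_of_rows_index)

lemma mat_adjoint_adjoint [simp]: "mat_adjoint (mat_adjoint A) = A"
  by (rule eq_matI) simp_all

lemma mat_adjoint_mult:
  fixes A B :: "complex mat"
  assumes "A \<in> carrier_mat m k" "B \<in> carrier_mat k n"
  shows "mat_adjoint (A * B) = mat_adjoint B * mat_adjoint A"
  using assms by (intro eq_matI) (auto simp: scalar_prod_def mult.commute intro!: sum.cong)

text \<open>Entry (j, j) of the Gram matrix is the squared norm of column j, so a vanishing diagonal
  kills every column. Condition (i) has this form.\<close>

lemma gram_eq_0_iff:
  fixes W :: "complex mat"
  assumes W: "W \<in> carrier_mat m n"
  shows "mat_adjoint W * W = 0\<^sub>m n n \<longleftrightarrow> W = 0\<^sub>m m n"
proof
  assume 0: "mat_adjoint W * W = 0\<^sub>m n n"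
  show "W = 0\<^sub>m m n"
  proof (rule eq_matI)
    fix i j assume "i < dim_row (0\<^sub>m m n)" "j < dim_col (0\<^sub>m m n)"
    then have ij: "i < m" "j < n" by auto
    have "(\<Sum>k<m. (cmod (W $$ (k, j)))\<^sup>2) = Re ((mat_adjoint W * W) $$ (j, j))"
      using W ij
      by (simp add: scalar_prod_def atLeast0LessThan mult.commute[of "cnj _"]
        flip: complex_norm_square of_real_sum of_real_power)
    also have "\<dots> = 0" using ij by (simp add: 0)
    finally have "\<forall>k\<in>{..<m}. (cmod (W $$ (k, j)))\<^sup>2 = 0"
      by (subst (asm) sum_nonneg_eq_0_iff) auto
    then show "W $$ (i, j) = 0\<^sub>m m n $$ (i, j)" using ij by simp
  qed (use W in auto)
qed (use W in auto)

lemma mat_eq_0_iff_mult_vec: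
  fixes W :: "complex mat"
  assumes W: "W \<in> carrier_mat m n"
  shows "W = 0\<^sub>m m n \<longleftrightarrow> (\<forall>v\<in>carrier_vec n. W *\<^sub>v v = 0\<^sub>v m)"
proof
  assume *: "\<forall>v\<in>carrier_vec n. W *\<^sub>v v = 0\<^sub>v m"
  show "W = 0\<^sub>m m n"
  proof (rule eq_matI)
    fix i j assume "i < dim_row (0\<^sub>m m n)" "j < dim_col (0\<^sub>m m n)"
    then have ij: "i < m" "j < n" by auto
    have "(W *\<^sub>v unit_vec n j) $ i = 0" using * ij by simp
    then show "W $$ (i, j) = 0\<^sub>m m n $$ (i, j)" using ij W by simp
  qed (use W in auto)
qed (use W in auto)

section \<open>Positive semidefinite matrices are Gram matrices\<close>

text \<open>Matrices and vectors are plain functions here, read only below \<open>m\<close>, so the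
  elimination in \<open>sesq_nonneg_decomp\<close> carries no dimension conditions.\<close>

definition sesq :: "nat \<Rightarrow> (nat \<Rightarrow> nat \<Rightarrow> complex) \<Rightarrow> (nat \<Rightarrow> complex) \<Rightarrow> (nat \<Rightarrow> complex) \<Rightarrow> complex" where
  "sesq m A u v = (\<Sum>i<m. \<Sum>j<m. cnj (u i) * A i j * v j)"

definition std :: "nat \<Rightarrow> nat \<Rightarrow> complex" where
  "std i k = of_bool (k = i)"

lemma sesq_add_smult:
  "sesq m A (\<lambda>k. u k + a * u' k) v = sesq m A u v + cnj a * sesq m A u' v"
  "sesq m A u (\<lambda>k. v k + a * v' k) = sesq m A u v + a * sesq m A u v'"
  by (simp_all add: sesq_def algebra_simps sum.distrib sum_distrib_left)

lemma sesq_std: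
  "i < m \<Longrightarrow> sesq m A (std i) v = (\<Sum>j<m. A i j * v j)"
  "j < m \<Longrightarrow> sesq m A u (std j) = (\<Sum>i<m. cnj (u i) * A i j)"
  by (simp_all add: sesq_def std_def sum.remove[of "{..<m}" i] sum.remove[of "{..<m}" j])

lemma sesq_std_std: "i < m \<Longrightarrow> j < m \<Longrightarrow> sesq m A (std i) (std j) = A i j"
  by (subst sesq_std(1)) (simp_all add: std_def)

text \<open>Polarization: the form is real at \<open>std i\<close> + \<open>std j\<close> and at
  \<open>std i\<close> + \<open>\<i>\<close> \<open>std j\<close>. The first fact relates the
  imaginary parts of the two entries, the second their real parts.\<close>

lemma sesq_nonneg_hermitian:
  assumes psd: "\<And>v. 0 \<le> sesq m A v v" and "i < m" "j < m"
  shows "A j i = cnj (A i j)"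
proof -
  have exp: "sesq m A (\<lambda>k. std i k + a * std j k) (\<lambda>k. std i k + a * std j k) =
      A i i + a * A i j + cnj a * A j i + cnj a * a * A j j" for a
    using assms(2,3) by (simp add: sesq_add_smult sesq_std_std algebra_simps)
  have real: "Im (A k k) = 0" if "k < m" for k
    using psd[of "std k"] that by (simp add: sesq_std_std less_eq_complex_def)
  have "Im (A i i + 1 * A i j + cnj 1 * A j i + cnj 1 * 1 * A j j) = 0"
    using psd[of "\<lambda>k. std i k + 1 * std j k"] unfolding exp by (simp add: less_eq_complex_def)
  moreover have "Im (A i i + \<i> * A i j + cnj \<i> * A j i + cnj \<i> * \<i> * A j j) = 0"
    using psd[of "\<lambda>k. std i k + \<i> * std j k"] unfolding exp by (simp add: less_eq_complex_def)
  ultimately show ?thesis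
    using real assms(2,3) by (simp add: complex_eq_iff)
qed

text \<open>With both diagonal entries zero there is no quadratic term, so the direction
  \<open>std i\<close> + a \<open>std j\<close> with a = -cnj (A i j) gives the value -2 |A i j|^2,
  which is negative unless the entry vanishes.\<close>

lemma sesq_nonneg_zero_diag:
  assumes psd: "\<And>v. 0 \<le> sesq m A v v" and ij: "i < m" "j < m" and 0: "A i i = 0" "A j j = 0"
  shows "A i j = 0"
proof -
  define a where "a = - cnj (A i j)"
  have "sesq m A (\<lambda>k. std i k + a * std j k) (\<lambda>k. std i k + a * std j k) =
      a * A i j + cnj a * A j i"
    using ij 0 by (simp add: sesq_add_smult sesq_std_std algebra_simps)
  also have "\<dots> = - 2 * of_real ((cmod (A i j))\<^sup>2)"
    unfolding sesq_nonneg_hermitian[OF psd ij]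
    by (simp add: a_def complex_norm_square[symmetric] algebra_simps)
  finally show ?thesis
    using psd[of "\<lambda>k. std i k + a * std j k"] by (simp add: less_eq_complex_def)
qed

text \<open>Shifting \<open>v\<close> by the multiple of the \<open>p\<close>-th unit vector that minimizes the form of \<open>A\<close>
  turns that form into the one of the Schur complement.\<close>
lemma sesq_nonneg_diff_rank_one:
  assumes psd: "\<And>v. 0 \<le> sesq m A v v" and p: "p < m" "A p p \<noteq> 0"
  shows "0 \<le> sesq m (\<lambda>i j. A i j - A i p * A p j / A p p) v v"
proof -
  define w where "w = (\<Sum>j<m. A p j * v j)"
  define c where "c = - (w / A p p)"
  have herm: "A j i = cnj (A i j)" if "i < m" "j < m" for i j
    using psd that by (rule sesq_nonneg_hermitian)
  have cw: "(\<Sum>i<m. cnj (v i) * A i p) = cnj w"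
    unfolding w_def cnj_sum
  proof (rule sum.cong)
    fix i assume "i \<in> {..<m}"
    then have "A i p = cnj (A p i)" using herm[of p i] p by simp
    then show "cnj (v i) * A i p = cnj (A p i * v i)" by simp
  qed simp
  have cd: "cnj (A p p) = A p p" using herm[of p p] p by simp
  have "sesq m (\<lambda>i j. A i j - A i p * A p j / A p p) v v =
      sesq m A v v - (\<Sum>i<m. \<Sum>j<m. (cnj (v i) * A i p) * (A p j * v j)) / A p p"
    by (simp add: sesq_def algebra_simps sum_subtractf sum_divide_distrib diff_divide_distrib)
  also have "\<dots> = sesq m A v v - cnj w * w / A p p"
    by (simp only: sum_product[symmetric] cw) (simp add: w_def)
  also have "\<dots> = sesq m A (\<lambda>k. v k + c * std p k) (\<lambda>k. v k + c * std p k)"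
    using sesq_std(1)[OF p(1), of A v] sesq_std(2)[OF p(1), of A v] sesq_std_std[OF p(1) p(1), of A]
      p(2)
    by (simp add: sesq_add_smult cw w_def[symmetric]) (simp add: c_def cd field_simps)
  finally show ?thesis using psd by simp
qed

text \<open>Cholesky elimination by outer products, with induction on the number of nonzero diagonal
  entries. A nonzero pivot splits off a rank-one term; without a pivot
  \<open>sesq_nonneg_zero_diag\<close> leaves the zero matrix and the empty list.\<close>

lemma sesq_nonneg_decomp:
  assumes "\<And>v. 0 \<le> sesq m A v v"
  shows "\<exists>ws. \<forall>i<m. \<forall>j<m. A i j = (\<Sum>w\<leftarrow>ws. w i * cnj (w j))"
  using assms
proof (induction "card {i. i < m \<and> A i i \<noteq> 0}" arbitrary: A rule: less_induct)
  case less
  note psd = less.prems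
  have herm: "A j i = cnj (A i j)" if "i < m" "j < m" for i j
    using psd that by (rule sesq_nonneg_hermitian)
  have diag: "0 \<le> A i i" if "i < m" for i
    using psd[of "std i"] that by (simp add: sesq_std_std)
  show ?case
  proof (cases "\<exists>p<m. A p p \<noteq> 0")
    case False
    then have "\<forall>i<m. \<forall>j<m. A i j = (\<Sum>w\<leftarrow>[]. w i * cnj (w j))"
      using sesq_nonneg_zero_diag[OF psd] by auto
    then show ?thesis by blast
  next
    case True
    then obtain p where p: "p < m" "A p p \<noteq> 0" by blast
    define B where "B = (\<lambda>i j. A i j - A i p * A p j / A p p)"
    have psdB: "0 \<le> sesq m B v v" for v
      unfolding B_def using psd p by (rule sesq_nonneg_diff_rank_one)
    obtain d where d: "A p p = of_real d" "0 < d"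
      using diag[OF p(1)] p(2) by (metis complex_eq_iff complex_of_real_def less_eq_complex_def
        less_le of_real_Re zero_complex.simps complex_is_Real_iff)
    have Bdiag: "B i i = A i i - of_real ((cmod (A i p))\<^sup>2 / d)" if "i < m" for i
    proof -
      have "A i p * A p i = of_real ((cmod (A i p))\<^sup>2)"
        by (simp only: herm[OF that p(1)] complex_norm_square)
      then show ?thesis by (simp add: B_def d)
    qed
    \<comment> \<open>Elimination only lowers diagonal entries and keeps them nonnegative, so a zero
      stays zero, while position \<open>p\<close> is newly cleared.\<close>
    have sub: "{i. i < m \<and> B i i \<noteq> 0} \<subseteq> {i. i < m \<and> A i i \<noteq> 0} - {p}"
    proof clarsimp
      fix i assume i: "i < m" "B i i \<noteq> 0"
      have "0 \<le> B i i" using psdB[of "std i"] i by (simp add: sesq_std_std)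
      moreover have "B p p = 0" using p by (simp add: B_def)
      ultimately show "A i i \<noteq> 0 \<and> i \<noteq> p"
        using i d by (auto simp: Bdiag less_eq_complex_def divide_nonneg_pos divide_le_0_iff)
    qed
    have "card {i. i < m \<and> B i i \<noteq> 0} < card {i. i < m \<and> A i i \<noteq> 0}"
      by (rule psubset_card_mono) (use sub p in auto)
    then obtain ws where ws: "\<forall>i<m. \<forall>j<m. B i j = (\<Sum>w\<leftarrow>ws. w i * cnj (w j))"
      using less.hyps psdB by blast
    \<comment> \<open>Column \<open>p\<close>, scaled so that its outer product with itself is the
      subtracted term; hermiticity turns the conjugated factor into row \<open>p\<close>.\<close>
    define u where "u i = A i p / of_real (sqrt d)" for i
    have "A i j = (\<Sum>w\<leftarrow>u # ws. w i * cnj (w j))" if "i < m" "j < m" for i j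
    proof -
      have "u i * cnj (u j) = A i p * A p j / A p p"
        using d that p herm[of j p] by (simp add: u_def flip: of_real_mult)
      moreover have "B i j = (\<Sum>w\<leftarrow>ws. w i * cnj (w j))" using ws that by blast
      ultimately show ?thesis by (simp add: B_def algebra_simps)
    qed
    then show ?thesis by blast
  qed
qed

text \<open>The columns are the vectors of \<open>sesq_nonneg_decomp\<close>. For the Choi matrix
  they become vectorized Kraus operators.\<close>

lemma psd_imp_gram:
  assumes "psd m A"
  shows "\<exists>vs. set vs \<subseteq> carrier_vec m \<and> A = mat_of_cols m vs * mat_adjoint (mat_of_cols m vs)"
proof -
  have A: "A \<in> carrier_mat m m" and pos: "\<And>v. v \<in> carrier_vec m \<Longrightarrow> 0 \<le> braket v (A *\<^sub>v v)"
    using assms by (auto simp: psd_def)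
  have "0 \<le> sesq m (\<lambda>i j. A $$ (i, j)) v v" for v
    using pos[of "vec m v"] A
    by (simp add: sesq_def braket_def scalar_prod_def atLeast0LessThan sum_distrib_right
        sum_distrib_left mult_ac)
  from sesq_nonneg_decomp[OF this] obtain ws where
    ws: "\<forall>i<m. \<forall>j<m. A $$ (i, j) = (\<Sum>w\<leftarrow>ws. w i * cnj (w j))" by blast
  have "A = mat_of_cols m (map (vec m) ws) * mat_adjoint (mat_of_cols m (map (vec m) ws))"
    using A ws
    by (intro eq_matI) (auto simp: scalar_prod_def mat_of_cols_index sum_list_sum_nth)
  then show ?thesis by (intro exI[of _ "map (vec m) ws"]) auto
qed

section \<open>The Choi matrix and Kraus operators\<close>

text \<open>Column stacking, matched to the index convention of \<open>kron\<close>: the result is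
  the sum of the |j> \<otimes> K|j>.\<close>

definition vectorize :: "nat \<Rightarrow> complex mat \<Rightarrow> complex vec" where
  "vectorize n K = vec (n * n) (\<lambda>i. K $$ (i mod n, i div n))"

definition unvectorize :: "nat \<Rightarrow> complex vec \<Rightarrow> complex mat" where
  "unvectorize n v = mat n n (\<lambda>(a, j). v $ (j * n + a))"

text \<open>The matrix V whose product with its adjoint will be the Choi matrix.\<close>

definition kraus_mat :: "nat \<Rightarrow> complex mat list \<Rightarrow> complex mat" where
  "kraus_mat n Ks = mat_of_cols (n * n) (map (vectorize n) Ks)"

lemma mult_add_less_mult:
  fixes i m a p :: nat
  assumes "i < m" "a < p"
  shows "i * p + a < m * p"
proof -
  have "i * p + a < Suc i * p" using assms by simp
  also have "\<dots> \<le> m * p" using assms by (intro mult_le_mono) auto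
  finally show ?thesis .
qed

lemma sum_square:
  fixes f :: "nat \<Rightarrow> 'a :: comm_monoid_add"
  shows "(\<Sum>i<n * n. f i) = (\<Sum>j<n. \<Sum>a<n. f (j * n + a))"
proof -
  have "(\<Sum>i<n * n. f i) = (\<Sum>j<n. sum f {j * n..<j * n + n})"
    by (rule sum.nat_group[symmetric])
  also have "\<dots> = (\<Sum>j<n. \<Sum>a<n. f (j * n + a))"
    using sum.shift_bounds_nat_ivl[of f 0 "_ * n" n]
    by (simp add: add.commute atLeast0LessThan)
  finally show ?thesis .
qed

lemma less_square_cases:
  fixes i n :: nat
  assumes "i < n * n"
  obtains j a where "j < n" "a < n" "i = j * n + a"
proof
  have "n > 0" using assms by (cases n) auto
  then show "i mod n < n" "i = i div n * n + i mod n" by simp_all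
  show "i div n < n" using assms by (simp add: less_mult_imp_div_less)
qed

lemma vectorize_carrier [simp]: "vectorize n K \<in> carrier_vec (n * n)"
  and unvectorize_carrier [simp]: "unvectorize n v \<in> carrier_mat n n"
  by (auto simp: vectorize_def unvectorize_def)

lemma dim_vectorize [simp]: "dim_vec (vectorize n K) = n * n"
  by (simp add: vectorize_def)

lemma index_vectorize: "j < n \<Longrightarrow> a < n \<Longrightarrow> vectorize n K $ (j * n + a) = K $$ (a, j)"
  by (simp add: vectorize_def mult_add_less_mult)

lemma unvectorize_vectorize: "K \<in> carrier_mat n n \<Longrightarrow> unvectorize n (vectorize n K) = K"
  by (intro eq_matI) (auto simp: unvectorize_def index_vectorize)

lemma vectorize_unvectorize: "v \<in> carrier_vec (n * n) \<Longrightarrow> vectorize n (unvectorize n v) = v"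
  by (intro eq_vecI) (auto simp: unvectorize_def vectorize_def less_mult_imp_div_less elim!: less_square_cases)

lemma kraus_mat_carrier [simp]: "kraus_mat n Ks \<in> carrier_mat (n * n) (length Ks)"
  by (auto simp: kraus_mat_def intro!: carrier_matI)

lemma dim_kraus_mat [simp]:
  "dim_row (kraus_mat n Ks) = n * n" "dim_col (kraus_mat n Ks) = length Ks"
  by (simp_all add: kraus_mat_def)

lemma index_kraus_mat:
  "j < n \<Longrightarrow> a < n \<Longrightarrow> l < length Ks \<Longrightarrow> kraus_mat n Ks $$ (j * n + a, l) = Ks ! l $$ (a, j)"
  by (simp add: kraus_mat_def mat_of_cols_index mult_add_less_mult index_vectorize)

lemma index_kraus_mat_gram:
  assumes "j < n" "a < n" "k < n" "b < n"
  shows "(kraus_mat n Ks * mat_adjoint (kraus_mat n Ks)) $$ (j * n + a, k * n + b) =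
    (\<Sum>l<length Ks. Ks ! l $$ (a, j) * cnj (Ks ! l $$ (b, k)))"
  using assms by (simp add: scalar_prod_def mult_add_less_mult atLeast0LessThan index_kraus_mat)

text \<open>Bridge from the abstract sum of the matrix module, in which \<open>choi\<close> and
  \<open>kraus_operators\<close> are stated, to sums of complex entries.\<close>

lemma finsum_mat_closed_index:
  fixes f :: "'b \<Rightarrow> 'a :: field mat"
  assumes f: "f \<in> S \<rightarrow> carrier_mat nr nc"
  shows "finsum (module_mat TYPE('a) nr nc) f S \<in> carrier_mat nr nc" (is ?C)
    and "finite S \<Longrightarrow> i < nr \<Longrightarrow> j < nc \<Longrightarrow>
      finsum (module_mat TYPE('a) nr nc) f S $$ (i, j) = (\<Sum>s\<in>S. f s $$ (i, j))"
proof -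
  interpret matrix_vs nr nc "TYPE('a)" .
  show ?C using f by (rule finsum_closed)
  assume "finite S" "i < nr" "j < nc"
  then show "finsum V f S $$ (i, j) = (\<Sum>s\<in>S. f s $$ (i, j))" using f
  proof (induction S rule: finite_induct)
    case (insert s S)
    then have "f s \<in> carrier_mat nr nc" "f \<in> S \<rightarrow> carrier_mat nr nc" by auto
    moreover from this have "dim_row (finsum V f S) = nr" "dim_col (finsum V f S) = nc"
      using finsum_closed by blast+
    ultimately show ?case using insert by (simp add: finsum_insert[OF insert(1,2)])
  qed simp
qed

section \<open>Outer and Kronecker products, and the entries of the Choi matrix\<close>

lemma outer_carrier [simp]: "u \<in> carrier_vec m \<Longrightarrow> v \<in> carrier_vec n \<Longrightarrow> outer u v \<in> carrier_mat m n"
  by (simp add: outer_def)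

lemma index_outer [simp]:
  "i < dim_vec u \<Longrightarrow> j < dim_vec v \<Longrightarrow> outer u v $$ (i, j) = u $ i * cnj (v $ j)"
  "dim_row (outer u v) = dim_vec u" "dim_col (outer u v) = dim_vec v"
  by (simp_all add: outer_def)

lemma kron_carrier [simp]:
  "A \<in> carrier_mat m n \<Longrightarrow> B \<in> carrier_mat p q \<Longrightarrow> kron A B \<in> carrier_mat (m * p) (n * q)"
  by (auto simp: kron_def)

lemma index_kron:
  assumes "A \<in> carrier_mat m n" "B \<in> carrier_mat p q" "i < m" "j < n" "a < p" "b < q"
  shows "kron A B $$ (i * p + a, j * q + b) = A $$ (i, j) * B $$ (a, b)"
  using assms by (auto simp: kron_def mult_add_less_mult)

abbreviation mat_unit :: "nat \<Rightarrow> nat \<Rightarrow> nat \<Rightarrow> complex mat" where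
  "mat_unit n j k \<equiv> outer (unit_vec n j) (unit_vec n k)"

lemma index_mat_unit:
  "a < n \<Longrightarrow> b < n \<Longrightarrow> j < n \<Longrightarrow> k < n \<Longrightarrow> mat_unit n j k $$ (a, b) = of_bool (a = j \<and> b = k)"
  by (simp add: unit_vec_def)

abbreviation linear_on_mats :: "nat \<Rightarrow> (complex mat \<Rightarrow> complex mat) \<Rightarrow> bool" where
  "linear_on_mats n \<Phi> \<equiv> \<Phi> \<in> LinearCombinations.module_hom class_ring (cmats n) (cmats n)"

lemma linear_on_mats_closed:
  "linear_on_mats n \<Phi> \<Longrightarrow> X \<in> carrier_mat n n \<Longrightarrow> \<Phi> X \<in> carrier_mat n n"
  by (auto simp: LinearCombinations.module_hom_def module_mat_simps)

lemma choi_carrier: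
  assumes "linear_on_mats n \<Phi>"
  shows "choi n \<Phi> \<in> carrier_mat (n * n) (n * n)"
  unfolding choi_def using linear_on_mats_closed[OF assms]
  by (intro finsum_mat_closed_index) auto

text \<open>The left Kronecker factors are matrix units, so only the summand (j, k) reaches block
  (j, k).\<close>

lemma index_choi:
  assumes lin: "linear_on_mats n \<Phi>" and "j < n" "k < n" "a < n" "b < n"
  shows "choi n \<Phi> $$ (j * n + a, k * n + b) = \<Phi> (mat_unit n j k) $$ (a, b)"
proof -
  have P: "\<Phi> (mat_unit n j k) \<in> carrier_mat n n" for j k
    using linear_on_mats_closed[OF lin] by simp
  have "choi n \<Phi> $$ (j * n + a, k * n + b) = (\<Sum>(j', k')\<in>{..<n} \<times> {..<n}.
      kron (mat_unit n j' k') (\<Phi> (mat_unit n j' k')) $$ (j * n + a, k * n + b))"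
    unfolding choi_def using P assms
    by (subst finsum_mat_closed_index) (auto simp: mult_add_less_mult case_prod_unfold)
  also have "\<dots> = (\<Sum>p\<in>{..<n} \<times> {..<n}. if p = (j, k) then \<Phi> (mat_unit n j k) $$ (a, b) else 0)"
    using P assms
    by (intro sum.cong) (auto simp: index_kron[OF _ P, of _ n n] index_mat_unit simp del: index_outer)
  also have "\<dots> = \<Phi> (mat_unit n j k) $$ (a, b)"
    using assms by simp
  finally show ?thesis .
qed

lemma linear_on_mats_finsum:
  assumes lin: "linear_on_mats n \<Phi>" and "finite S" and f: "f \<in> S \<rightarrow> carrier_mat n n"
  shows "\<Phi> (finsum (cmats n) f S) = finsum (cmats n) (\<lambda>s. \<Phi> (f s)) S"
proof -
  interpret M: matrix_vs n n "TYPE(complex)" .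
  interpret mod_hom class_ring "cmats n" "cmats n" \<Phi>
    using lin by unfold_locales
  show ?thesis using assms(2) f
  proof (induction S rule: finite_induct)
    case empty
    then show ?case using f0_is_0 by (simp add: module_mat_simps)
  next
    case (insert s S)
    then have fs: "f s \<in> carrier_mat n n" "f \<in> S \<rightarrow> carrier_mat n n" by auto
    then have "(\<lambda>s. \<Phi> (f s)) \<in> S \<rightarrow> carrier_mat n n" "\<Phi> (f s) \<in> carrier_mat n n"
      using linear_on_mats_closed[OF lin] by auto
    with fs show ?case
      using insert f_add[of "f s" "finsum (cmats n) f S"] finsum_mat_closed_index(1)[of f S n n]
      by (simp add: M.finsum_insert[OF insert(1,2)] module_mat_simps)
  qed
qed

text \<open>Expanding \<open>X\<close> in matrix units and using linearity recovers the map from its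
  Choi matrix.\<close>

lemma index_linear_on_mats:
  assumes lin: "linear_on_mats n \<Phi>" and X: "X \<in> carrier_mat n n" and ab: "a < n" "b < n"
  shows "\<Phi> X $$ (a, b) = (\<Sum>j<n. \<Sum>k<n. X $$ (j, k) * choi n \<Phi> $$ (j * n + a, k * n + b))"
proof -
  interpret M: matrix_vs n n "TYPE(complex)" .
  interpret mod_hom class_ring "cmats n" "cmats n" \<Phi>
    using lin by unfold_locales
  let ?S = "{..<n} \<times> {..<n}" and ?f = "\<lambda>(j, k). X $$ (j, k) \<cdot>\<^sub>m mat_unit n j k"
  have f: "?f \<in> ?S \<rightarrow> carrier_mat n n" by auto
  have sums: "(\<Sum>p\<in>?S. g (fst p) (snd p)) = (\<Sum>j<n. \<Sum>k<n. g j k)" for g :: "nat \<Rightarrow> nat \<Rightarrow> complex"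
    by (simp add: sum.cartesian_product case_prod_unfold)
  have "X = finsum (cmats n) ?f ?S"
  proof (rule eq_matI)
    fix i j assume "i < dim_row (finsum (cmats n) ?f ?S)" "j < dim_col (finsum (cmats n) ?f ?S)"
    then have ij: "i < n" "j < n" using finsum_mat_closed_index(1)[OF f] by auto
    have "finsum (cmats n) ?f ?S $$ (i, j) = (\<Sum>p\<in>?S. ?f p $$ (i, j))"
      using ij by (intro finsum_mat_closed_index[OF f]) auto
    also have "\<dots> = (\<Sum>p\<in>?S. if p = (i, j) then X $$ (i, j) else 0)"
      using ij by (intro sum.cong) (auto simp: index_mat_unit simp del: index_outer(1))
    finally have "finsum (cmats n) ?f ?S $$ (i, j) = \<dots>" .
    then show "X $$ (i, j) = finsum (cmats n) ?f ?S $$ (i, j)" using ij by simp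
  qed (use X finsum_mat_closed_index(1)[OF f] in auto)
  then have "\<Phi> X = \<Phi> (finsum (cmats n) ?f ?S)" by simp
  also have "\<dots> = finsum (cmats n) (\<lambda>p. \<Phi> (?f p)) ?S"
    using f by (intro linear_on_mats_finsum[OF lin]) auto
  also have "\<dots> $$ (a, b) = (\<Sum>p\<in>?S. X $$ p * choi n \<Phi> $$ (fst p * n + a, snd p * n + b))"
  proof (subst finsum_mat_closed_index)
    show "(\<Sum>p\<in>?S. \<Phi> (?f p) $$ (a, b)) =
        (\<Sum>p\<in>?S. X $$ p * choi n \<Phi> $$ (fst p * n + a, snd p * n + b))"
    proof (intro sum.cong refl)
      fix p assume "p \<in> ?S"
      then obtain j k where p: "p = (j, k)" "j < n" "k < n" by auto
      have "\<Phi> (X $$ (j, k) \<cdot>\<^sub>m mat_unit n j k) = X $$ (j, k) \<cdot>\<^sub>m \<Phi> (mat_unit n j k)"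
        using f_smult[of "X $$ (j, k)" "mat_unit n j k"] by (simp add: module_mat_simps class_ring_simps)
      then show "\<Phi> (?f p) $$ (a, b) = X $$ p * choi n \<Phi> $$ (fst p * n + a, snd p * n + b)"
        using ab p linear_on_mats_closed[OF lin, of "mat_unit n j k"]
        by (simp add: index_choi[OF lin])
    qed
  qed (use ab linear_on_mats_closed[OF lin] f in auto)
  also have "\<dots> = (\<Sum>j<n. \<Sum>k<n. X $$ (j, k) * choi n \<Phi> $$ (j * n + a, k * n + b))"
    by (subst sums[symmetric]) simp
  finally show ?thesis .
qed

section \<open>Kraus families as factorizations of the Choi matrix\<close>

lemma index_mult_mult_adjoint:
  assumes "K \<in> carrier_mat n n" "X \<in> carrier_mat n n" "a < n" "b < n"
  shows "(K * X * mat_adjoint K) $$ (a, b) =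
    (\<Sum>j<n. \<Sum>k<n. X $$ (j, k) * (K $$ (a, j) * cnj (K $$ (b, k))))"
proof -
  have "(K * X * mat_adjoint K) $$ (a, b) =
      (\<Sum>k<n. \<Sum>j<n. X $$ (j, k) * (K $$ (a, j) * cnj (K $$ (b, k))))"
    using assms by (simp add: scalar_prod_def atLeast0LessThan sum_distrib_left mult_ac)
  then show ?thesis by (subst sum.swap)
qed

text \<open>The formula has the shape of \<open>index_linear_on_mats\<close>, with the Gram matrix
  of the vectorized operators in place of \<open>choi\<close>, so that the two can be compared entry
  by entry.\<close>

lemma index_kraus_sum:
  assumes Ks: "set Ks \<subseteq> carrier_mat n n" and X: "X \<in> carrier_mat n n" and ab: "a < n" "b < n"
  shows "finsum (cmats n) (\<lambda>l. Ks ! l * X * mat_adjoint (Ks ! l)) {..<length Ks} $$ (a, b) =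
    (\<Sum>j<n. \<Sum>k<n. X $$ (j, k) * (kraus_mat n Ks * mat_adjoint (kraus_mat n Ks)) $$ (j * n + a, k * n + b))"
proof -
  have K: "Ks ! l \<in> carrier_mat n n" if "l < length Ks" for l
    using Ks that by (auto dest: nth_mem)
  have "finsum (cmats n) (\<lambda>l. Ks ! l * X * mat_adjoint (Ks ! l)) {..<length Ks} $$ (a, b) =
      (\<Sum>l<length Ks. \<Sum>j<n. \<Sum>k<n. X $$ (j, k) * (Ks ! l $$ (a, j) * cnj (Ks ! l $$ (b, k))))"
    using K X ab
    by (subst finsum_mat_closed_index) (auto intro!: sum.cong index_mult_mult_adjoint mult_carrier_mat[of _ n n])
  also have "\<dots> = (\<Sum>j<n. \<Sum>l<length Ks. \<Sum>k<n. X $$ (j, k) * (Ks ! l $$ (a, j) * cnj (Ks ! l $$ (b, k))))"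
    by (rule sum.swap)
  also have "\<dots> = (\<Sum>j<n. \<Sum>k<n. \<Sum>l<length Ks. X $$ (j, k) * (Ks ! l $$ (a, j) * cnj (Ks ! l $$ (b, k))))"
    by (intro sum.cong refl sum.swap)
  also have "\<dots> = (\<Sum>j<n. \<Sum>k<n. X $$ (j, k) *
      (kraus_mat n Ks * mat_adjoint (kraus_mat n Ks)) $$ (j * n + a, k * n + b))"
    using ab by (intro sum.cong refl) (simp add: index_kraus_mat_gram sum_distrib_left)
  finally show ?thesis .
qed

text \<open>Forwards, evaluating at matrix units isolates the single entries of the Gram matrix.
  Backwards, \<open>index_linear_on_mats\<close> and \<open>index_kraus_sum\<close> express both
  maps by the same entries.\<close>

lemma kraus_operators_iff_choi:
  assumes lin: "linear_on_mats n \<Phi>" and Ks: "set Ks \<subseteq> carrier_mat n n"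
  shows "kraus_operators n \<Phi> Ks \<longleftrightarrow> choi n \<Phi> = kraus_mat n Ks * mat_adjoint (kraus_mat n Ks)"
    (is "_ \<longleftrightarrow> _ = ?G")
proof
  assume kr: "kraus_operators n \<Phi> Ks"
  have G: "?G \<in> carrier_mat (n * n) (n * n)"
    by (intro mult_carrier_mat[of _ _ "length Ks"] mat_adjoint_carrier kraus_mat_carrier)
  show "choi n \<Phi> = ?G"
  proof (rule eq_matI)
    fix i i' assume "i < dim_row ?G" "i' < dim_col ?G"
    then have "i < n * n" "i' < n * n" using G by auto
    then obtain j a k b where *: "j < n" "a < n" "i = j * n + a" "k < n" "b < n" "i' = k * n + b"
      by (metis less_square_cases)
    have "choi n \<Phi> $$ (i, i') = \<Phi> (mat_unit n j k) $$ (a, b)"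
      using * by (simp add: index_choi[OF lin])
    also have "\<dots> = (\<Sum>j'<n. \<Sum>k'<n. mat_unit n j k $$ (j', k') * ?G $$ (j' * n + a, k' * n + b))"
      using kr * Ks unfolding kraus_operators_def by (subst index_kraus_sum[symmetric]) auto
    also have "\<dots> = (\<Sum>j'<n. \<Sum>k'<n. if k' = k then of_bool (j' = j) * ?G $$ (j' * n + a, k * n + b) else 0)"
      using * by (intro sum.cong refl) (auto simp: index_mat_unit simp del: index_outer)
    also have "\<dots> = (\<Sum>j'<n. if j' = j then ?G $$ (j * n + a, k * n + b) else 0)"
      using * by (intro sum.cong refl) auto
    also have "\<dots> = ?G $$ (i, i')" using * by simp
    finally show "choi n \<Phi> $$ (i, i') = ?G $$ (i, i')" .
  qed (use G choi_carrier[OF lin] in auto)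
next
  assume eq: "choi n \<Phi> = ?G"
  have "\<Phi> X = finsum (cmats n) (\<lambda>l. Ks ! l * X * mat_adjoint (Ks ! l)) {..<length Ks}"
    if X: "X \<in> carrier_mat n n" for X
  proof -
    have "finsum (cmats n) (\<lambda>l. Ks ! l * X * mat_adjoint (Ks ! l)) {..<length Ks} \<in> carrier_mat n n"
      using Ks X by (intro finsum_mat_closed_index) (auto intro!: mult_carrier_mat[of _ n n] dest: nth_mem)
    then show ?thesis
      using linear_on_mats_closed[OF lin X] index_linear_on_mats[OF lin X] index_kraus_sum[OF Ks X]
      by (intro eq_matI) (auto simp: eq)
  qed
  then show "kraus_operators n \<Phi> Ks" using Ks by (simp add: kraus_operators_def)
qed

text \<open>Let w be the vectorized identity, that is, the sum of the |j> \<otimes> |j>. The form of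
  |w><w| at v is |<w|v>|^2, and block (j, k) of |w><w| is a matrix unit, so amplifying \<Phi> at
  this positive matrix yields the Choi matrix.\<close>

lemma psd_choi:
  assumes "completely_positive n \<Phi>"
  shows "psd (n * n) (choi n \<Phi>)"
proof -
  have lin: "linear_on_mats n \<Phi>" using assms by (simp add: completely_positive_def)
  define w where "w = vectorize n (1\<^sub>m n)"
  have w: "w \<in> carrier_vec (n * n)" by (simp add: w_def)
  have "braket v (outer w w *\<^sub>v v) = (v \<bullet>c w) * conjugate (v \<bullet>c w)" if "v \<in> carrier_vec (n * n)" for v
  proof -
    have "outer w w *\<^sub>v v = (v \<bullet>c w) \<cdot>\<^sub>v w"
      using that w by (intro eq_vecI) (auto simp: scalar_prod_def sum_distrib_left mult_ac)
    moreover have "w \<bullet>c v = conjugate (v \<bullet>c w)"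
      using that w by (simp add: scalar_prod_def mult.commute)
    ultimately show ?thesis
      using that w by (simp add: braket_def)
  qed
  then have "psd (n * n) (outer w w)"
    using w by (auto simp: psd_def less_eq_complex_def)
  then have "psd (n * n) (amplify n n \<Phi> (outer w w))"
    using assms by (simp add: completely_positive_def)
  moreover have "amplify n n \<Phi> (outer w w) = choi n \<Phi>"
  proof (rule eq_matI)
    fix i i' assume "i < dim_row (choi n \<Phi>)" "i' < dim_col (choi n \<Phi>)"
    then have "i < n * n" "i' < n * n" using choi_carrier[OF lin] by auto
    then obtain j a k b where *: "j < n" "a < n" "i = j * n + a" "k < n" "b < n" "i' = k * n + b"
      by (metis less_square_cases)
    have "mat n n (\<lambda>(a, b). outer w w $$ (j * n + a, k * n + b)) = mat_unit n j k"
      using * w by (intro eq_matI)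
        (auto simp: w_def index_vectorize mult_add_less_mult unit_vec_def)
    then show "amplify n n \<Phi> (outer w w) $$ (i, i') = choi n \<Phi> $$ (i, i')"
      using * by (simp add: amplify_def mult_add_less_mult index_choi[OF lin])
  qed (use choi_carrier[OF lin] in \<open>auto simp: amplify_def\<close>)
  ultimately show ?thesis by simp
qed

text \<open>The columns of a Gram factor of the Choi matrix, read back as n x n matrices, are Kraus
  operators. Hence the \<open>SOME\<close> in \<open>kraus_subspace\<close> picks an actual Kraus
  family.\<close>

lemma kraus_operators_exist:
  assumes "completely_positive n \<Phi>"
  shows "\<exists>Ks. kraus_operators n \<Phi> Ks"
proof -
  have lin: "linear_on_mats n \<Phi>" using assms by (simp add: completely_positive_def)
  obtain vs where vs: "set vs \<subseteq> carrier_vec (n * n)"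
    "choi n \<Phi> = mat_of_cols (n * n) vs * mat_adjoint (mat_of_cols (n * n) vs)"
    using psd_imp_gram[OF psd_choi[OF assms]] by blast
  have "map (vectorize n) (map (unvectorize n) vs) = vs"
    using vs(1) by (auto simp: vectorize_unvectorize intro!: map_idI)
  then have "kraus_operators n \<Phi> (map (unvectorize n) vs)"
    using vs(2) by (subst kraus_operators_iff_choi[OF lin]) (auto simp: kraus_mat_def)
  then show ?thesis ..
qed

section \<open>Kernels of Gram matrices\<close>

lemma mult_vec_cscalar_prod:
  fixes A :: "complex mat"
  assumes "A \<in> carrier_mat m n" "v \<in> carrier_vec n" "u \<in> carrier_vec m"
  shows "(A *\<^sub>v v) \<bullet>c u = v \<bullet>c (mat_adjoint A *\<^sub>v u)"
proof -
  have "(A *\<^sub>v v) \<bullet>c u = (\<Sum>i<m. \<Sum>j<n. A $$ (i, j) * v $ j * cnj (u $ i))"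
    using assms by (simp add: scalar_prod_def atLeast0LessThan sum_distrib_right)
  also have "\<dots> = (\<Sum>j<n. \<Sum>i<m. A $$ (i, j) * v $ j * cnj (u $ i))"
    by (rule sum.swap)
  also have "\<dots> = v \<bullet>c (mat_adjoint A *\<^sub>v u)"
    using assms by (simp add: scalar_prod_def atLeast0LessThan sum_distrib_left mult_ac)
  finally show ?thesis .
qed

text \<open>The squared norm of the adjoint of \<open>W\<close> applied to \<open>g\<close> is the
  inner product of \<open>g\<close> with \<open>W * mat_adjoint W\<close> applied to
  \<open>g\<close>. This serves both the kernel of the Choi matrix and condition (ii).\<close>

lemma gram_mult_vec_eq_0_iff:
  fixes W :: "complex mat"
  assumes W: "W \<in> carrier_mat m k" and g: "g \<in> carrier_vec m"
  shows "(W * mat_adjoint W) *\<^sub>v g = 0\<^sub>v m \<longleftrightarrow> mat_adjoint W *\<^sub>v g = 0\<^sub>v k"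
proof
  have W': "mat_adjoint W \<in> carrier_mat k m" using W by simp
  have Wg: "mat_adjoint W *\<^sub>v g \<in> carrier_vec k" using W' g by simp
  have assoc: "(W * mat_adjoint W) *\<^sub>v g = W *\<^sub>v (mat_adjoint W *\<^sub>v g)"
    using W W' g by (rule assoc_mult_mat_vec)
  show "mat_adjoint W *\<^sub>v g = 0\<^sub>v k" if 0: "(W * mat_adjoint W) *\<^sub>v g = 0\<^sub>v m"
  proof -
    have "(mat_adjoint W *\<^sub>v g) \<bullet>c (mat_adjoint W *\<^sub>v g) = g \<bullet>c (W *\<^sub>v (mat_adjoint W *\<^sub>v g))"
      using mult_vec_cscalar_prod[OF W' g Wg] by simp
    also have "\<dots> = 0" using 0 g by (simp add: assoc)
    finally show ?thesis using conjugate_square_eq_0_vec[OF Wg] by blast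
  qed
  show "(W * mat_adjoint W) *\<^sub>v g = 0\<^sub>v m" if "mat_adjoint W *\<^sub>v g = 0\<^sub>v k"
    using that W by (auto simp: assoc scalar_prod_def intro!: eq_vecI)
qed

section \<open>The orthogonal complement of the Kraus subspace\<close>

lemma submodule_matI:
  fixes N :: "'a :: field mat set"
  assumes "N \<subseteq> carrier_mat nr nc" "0\<^sub>m nr nc \<in> N"
    and "\<And>A B. A \<in> N \<Longrightarrow> B \<in> N \<Longrightarrow> A + B \<in> N" and "\<And>c A. A \<in> N \<Longrightarrow> c \<cdot>\<^sub>m A \<in> N"
  shows "submodule class_ring N (module_mat TYPE('a) nr nc)"
proof -
  interpret matrix_vs nr nc "TYPE('a)" .
  show ?thesis
    using assms module_axioms by (auto simp: submodule_def module_mat_simps class_ring_simps)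
qed

lemma mat_trace_adjoint_mult:
  assumes "K \<in> carrier_mat n n" "G \<in> carrier_mat n n"
  shows "mat_trace (mat_adjoint K * G) = (\<Sum>j<n. \<Sum>a<n. cnj (K $$ (a, j)) * G $$ (a, j))"
  using assms by (simp add: mat_trace_def scalar_prod_def atLeast0LessThan)

lemma index_adjoint_kraus_mat_mult_vec:
  assumes "l < length Ks" "v \<in> carrier_vec (n * n)"
  shows "(mat_adjoint (kraus_mat n Ks) *\<^sub>v v) $ l =
    (\<Sum>j<n. \<Sum>a<n. cnj (Ks ! l $$ (a, j)) * v $ (j * n + a))"
proof -
  have "(mat_adjoint (kraus_mat n Ks) *\<^sub>v v) $ l = (\<Sum>i<n * n. cnj (kraus_mat n Ks $$ (i, l)) * v $ i)"
    using assms by (simp add: scalar_prod_def atLeast0LessThan)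
  also have "\<dots> = (\<Sum>j<n. \<Sum>a<n. cnj (Ks ! l $$ (a, j)) * v $ (j * n + a))"
    unfolding sum_square using assms by (intro sum.cong refl) (simp add: index_kraus_mat)
  finally show ?thesis .
qed

text \<open>The traces are the entries of the adjoint of \<open>kraus_mat n Ks\<close> applied to
  \<open>vectorize n G\<close>, and that adjoint has the same kernel as the Gram matrix, which is
  \<open>choi n \<Phi>\<close>.\<close>

lemma orthogonal_kraus_operators_iff:
  assumes lin: "linear_on_mats n \<Phi>" and kr: "kraus_operators n \<Phi> Ks" and G: "G \<in> carrier_mat n n"
  shows "(\<forall>K\<in>set Ks. mat_trace (mat_adjoint K * G) = 0) \<longleftrightarrow> vectorize n G \<in> mat_kernel (choi n \<Phi>)"
proof -
  have Ks: "set Ks \<subseteq> carrier_mat n n" using kr by (simp add: kraus_operators_def)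
  have "(mat_adjoint (kraus_mat n Ks) *\<^sub>v vectorize n G) $ l = mat_trace (mat_adjoint (Ks ! l) * G)"
    if "l < length Ks" for l
  proof -
    have "Ks ! l \<in> carrier_mat n n" using Ks nth_mem[OF that] by blast
    then show ?thesis
      using that G
      by (simp add: index_adjoint_kraus_mat_mult_vec mat_trace_adjoint_mult[of _ n] index_vectorize
          del: index_mult_mat_vec)
  qed
  then have "(\<forall>K\<in>set Ks. mat_trace (mat_adjoint K * G) = 0) \<longleftrightarrow>
      mat_adjoint (kraus_mat n Ks) *\<^sub>v vectorize n G = 0\<^sub>v (length Ks)"
    by (auto simp: all_set_conv_all_nth vec_eq_iff)
  also have "\<dots> \<longleftrightarrow> choi n \<Phi> *\<^sub>v vectorize n G = 0\<^sub>v (n * n)"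
    using kr by (subst gram_mult_vec_eq_0_iff[symmetric, of _ "n * n"])
      (auto simp: kraus_operators_iff_choi[OF lin Ks])
  finally show ?thesis using choi_carrier[OF lin] by (simp add: mat_kernel)
qed

text \<open>The kernel does not refer to any Kraus operators, so this description removes the
  arbitrary choice inside \<open>kraus_subspace\<close>.\<close>

lemma mem_kraus_perp_iff:
  assumes lin: "linear_on_mats n \<Phi>" and ex: "\<exists>Ks. kraus_operators n \<Phi> Ks"
  shows "G \<in> kraus_perp n \<Phi> \<longleftrightarrow> G \<in> carrier_mat n n \<and> vectorize n G \<in> mat_kernel (choi n \<Phi>)"
proof (cases "G \<in> carrier_mat n n")
  case G: True
  define Ks where "Ks = (SOME Ks. kraus_operators n \<Phi> Ks)"
  have kr: "kraus_operators n \<Phi> Ks" unfolding Ks_def using ex by (rule someI_ex)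
  then have Ks: "set Ks \<subseteq> carrier_mat n n" by (simp add: kraus_operators_def)
  interpret M: matrix_vs n n "TYPE(complex)" .
  \<comment> \<open>For fixed \<open>G\<close> the trace is conjugate-linear in \<open>K\<close>, so
    its zero set is a complex subspace and orthogonality passes from the operators to their
    span.\<close>
  let ?N = "{K \<in> carrier_mat n n. mat_trace (mat_adjoint K * G) = 0}"
  have "submodule class_ring ?N (cmats n)"
    using G by (intro submodule_matI)
      (auto simp: mat_trace_adjoint_mult[of _ n] distrib_right sum.distrib mult.assoc simp flip: sum_distrib_left)
  then have "M.span (set Ks) \<subseteq> ?N" if "set Ks \<subseteq> ?N"
    using that by (intro M.span_is_subset) auto
  moreover have "set Ks \<subseteq> M.span (set Ks)" using Ks by (intro M.in_own_span) auto
  ultimately have "G \<in> kraus_perp n \<Phi> \<longleftrightarrow> (\<forall>K\<in>set Ks. mat_trace (mat_adjoint K * G) = 0)"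
    using G Ks by (auto simp: kraus_perp_def kraus_subspace_def Ks_def[symmetric])
  with G show ?thesis by (simp add: orthogonal_kraus_operators_iff[OF lin kr G])
qed (simp add: kraus_perp_def)

text \<open>The complement is the preimage of the kernel of the Choi matrix under the linear map
  \<open>vectorize n\<close>.\<close>

lemma submodule_kraus_perp:
  assumes lin: "linear_on_mats n \<Phi>" and ex: "\<exists>Ks. kraus_operators n \<Phi> Ks"
  shows "submodule class_ring (kraus_perp n \<Phi>) (cmats n)"
proof (rule submodule_matI)
  note C = choi_carrier[OF lin]
  note iff = mem_kraus_perp_iff[OF lin ex] mat_kernel[OF C]
  have zero: "vectorize n (0\<^sub>m n n) = 0\<^sub>v (n * n)"
    by (intro eq_vecI) (auto simp: vectorize_def less_mult_imp_div_less elim!: less_square_cases)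
  have add: "vectorize n (A + B) = vectorize n A + vectorize n B"
    if "A \<in> carrier_mat n n" "B \<in> carrier_mat n n" for A B
    using that by (intro eq_vecI) (auto simp: vectorize_def less_mult_imp_div_less elim!: less_square_cases)
  have smult: "vectorize n (c \<cdot>\<^sub>m A) = c \<cdot>\<^sub>v vectorize n A" if "A \<in> carrier_mat n n" for c A
    using that by (intro eq_vecI) (auto simp: vectorize_def less_mult_imp_div_less elim!: less_square_cases)
  show "kraus_perp n \<Phi> \<subseteq> carrier_mat n n" by (auto simp: kraus_perp_def)
  show "0\<^sub>m n n \<in> kraus_perp n \<Phi>" using C by (auto simp: iff zero)
  show "A + B \<in> kraus_perp n \<Phi>" if "A \<in> kraus_perp n \<Phi>" "B \<in> kraus_perp n \<Phi>" for A B
    using that C by (auto simp: iff add mult_add_distrib_mat_vec[OF C])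
  show "c \<cdot>\<^sub>m A \<in> kraus_perp n \<Phi>" if "A \<in> kraus_perp n \<Phi>" for c A
    using that C by (auto simp: iff smult mult_mat_vec[OF C])
qed

text \<open>Condition (iii) quantifies over bases of the complement and would be vacuous if there
  were none. Existence is inherited from the kernel of the Choi matrix: it has a finite basis, and
  \<open>unvectorize\<close> maps it linearly onto the complement.\<close>

lemma kraus_perp_basis_exists:
  assumes lin: "linear_on_mats n \<Phi>" and ex: "\<exists>Ks. kraus_operators n \<Phi> Ks"
  shows "\<exists>Gs. vectorspace.basis class_ring ((cmats n)\<lparr>carrier := kraus_perp n \<Phi>\<rparr>) Gs"
proof -
  note C = choi_carrier[OF lin]
  interpret M: matrix_vs n n "TYPE(complex)" .
  interpret K: kernel "n * n" "n * n" "choi n \<Phi>" by unfold_locales (rule C)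
  let ?P = "(cmats n)\<lparr>carrier := kraus_perp n \<Phi>\<rparr>"
  have P: "vectorspace class_ring ?P"
    using submodule_kraus_perp[OF assms] M.vectorspace_axioms
    by (intro M.subspace_is_vs VectorSpace.subspace.intro)
  have "K.Ker.fin_dim"
    using kernel_basis_exists[OF C] unfolding K.Ker.fin_dim_def K.Ker.basis_def by blast
  moreover have "linear_map class_ring K.VK ?P (unvectorize n)"
  proof -
    have "unvectorize n \<in> LinearCombinations.module_hom class_ring K.VK ?P"
      unfolding LinearCombinations.module_hom_def
      using mat_kernel_carrier[OF C]
      by (auto simp: module_mat_simps module_vec_simps class_ring_simps mem_kraus_perp_iff[OF assms]
          vectorize_unvectorize subset_iff)
        (auto simp: unvectorize_def mult_add_less_mult subset_iff intro!: eq_matI)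
    then show ?thesis
      using P K.Ker.vectorspace_axioms
      by (simp add: linear_map_def mod_hom_def mod_hom_axioms_def vectorspace_def)
  qed
  moreover have "unvectorize n ` carrier K.VK = carrier ?P"
  proof -
    have "G \<in> unvectorize n ` mat_kernel (choi n \<Phi>)" if "G \<in> kraus_perp n \<Phi>" for G
      using that unvectorize_vectorize[of G n] by (auto simp: mem_kraus_perp_iff[OF assms] image_iff intro: bexI[of _ "vectorize n G"])
    moreover have "unvectorize n v \<in> kraus_perp n \<Phi>" if "v \<in> mat_kernel (choi n \<Phi>)" for v
      using that mat_kernel_carrier[OF C]
      by (auto simp: mem_kraus_perp_iff[OF assms] vectorize_unvectorize subset_iff)
    ultimately show ?thesis by auto
  qed
  ultimately have "vectorspace.fin_dim class_ring ?P"
    using linear_map.surj_fin_dim by blast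
  then show ?thesis using vectorspace.finite_basis_exists[OF P] by blast
qed

section \<open>Orthonormal bases of kernels\<close>

text \<open>The columns are an orthonormal basis of the kernel, obtained from an arbitrary basis by
  Gram-Schmidt and normalization.\<close>

lemma unitary_onto_kernel_exists:
  fixes A :: "complex mat"
  assumes A: "A \<in> carrier_mat m m"
  defines "d \<equiv> m - vec_space.rank m A"
  shows "\<exists>\<iota>\<in>carrier_mat m d. mat_adjoint \<iota> * \<iota> = 1\<^sub>m d \<and> (\<lambda>v. \<iota> *\<^sub>v v) ` carrier_vec d = mat_kernel A"
proof -
  interpret cof_vec_space m "TYPE(complex)" .
  interpret K: kernel m m A by unfold_locales (rule A)
  obtain B where B: "finite B" "K.basis B" using kernel_basis_exists[OF A] by blast
  have Bker: "B \<subseteq> mat_kernel A" using B(2) by (simp add: K.Ker.basis_def)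
  \<comment> \<open>Rank-nullity for the map v to A v, whose image is the column space that defines
    \<open>rank\<close>.\<close>
  have "card B = d"
  proof -
    have hom: "(*\<^sub>v) A \<in> LinearCombinations.module_hom class_ring V V"
      using A by (auto simp: LinearCombinations.module_hom_def module_vec_simps class_ring_simps
          mult_add_distrib_mat_vec[OF A] mult_mat_vec[OF A])
    interpret T: linear_map class_ring V V "(*\<^sub>v) A"
      using hom vectorspace_axioms by (simp add: linear_map_def mod_hom_def mod_hom_axioms_def vectorspace_def)
    have "T.imT = span (set (cols A))"
      using col_space_eq[OF A] A by (auto simp: T.im_def col_space_def image_def)
    moreover have "T.kerT = mat_kernel A"
      by (simp add: T.ker_def mat_kernel[OF A])
    ultimately have "rank A + K.dim = m"
      using T.rank_nullity[OF fin_dim] by (simp add: rank_def dim_is_n)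
    then show ?thesis using K.Ker.dim_basis[OF B] by (simp add: d_def)
  qed
  obtain ws where ws: "set ws = B" "distinct ws" using finite_distinct_list[OF B(1)] by blast
  have wsc: "set ws \<subseteq> carrier_vec m" using ws Bker mat_kernel_carrier[OF A] by auto
  \<comment> \<open>Independence is moved from the kernel to the ambient space, where
    \<open>gram_schmidt\<close> operates.\<close>
  have "\<not> lin_dep (set ws)"
    using B(2) K.lindep_same[OF Bker] ws by (simp add: K.Ker.basis_def)
  define us where "us = gram_schmidt m ws"
  note gs = gram_schmidt_result[OF wsc ws(2) \<open>\<not> lin_dep (set ws)\<close> us_def]
  have len: "length us = d" using gs(4) ws \<open>card B = d\<close> distinct_card by metis
  have uc: "us ! p \<in> carrier_vec m" if "p < d" for p using gs(3) len that by auto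
  have span_us: "span (set us) = mat_kernel A"
    using gs(1) ws B(2) K.span_same[OF Bker] by (simp add: K.Ker.basis_def)
  \<comment> \<open>Gram-Schmidt here delivers orthogonal but unnormalized vectors;
    \<open>r p\<close> is the norm of \<open>us ! p\<close>.\<close>
  define r where "r p = sqrt (Re (us ! p \<bullet>c us ! p))" for p
  have rr: "us ! p \<bullet>c us ! p = of_real (r p * r p)" "r p > 0" if "p < d" for p
  proof -
    \<comment> \<open>At equal indices \<open>corthogonalD\<close> says that the inner product does
      not vanish.\<close>
    have "us ! p \<bullet>c us ! p \<noteq> 0" using corthogonalD[OF gs(2), of p p] that len by simp
    then have "us ! p \<bullet>c us ! p > 0"
      using conjugate_square_greater_0_vec[OF uc[OF that]] uc[OF that] by fastforce
    then show "us ! p \<bullet>c us ! p = of_real (r p * r p)" "r p > 0"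
      by (auto simp: r_def less_complex_def complex_eq_iff)
  qed
  have r0: "r p \<noteq> 0" if "p < length us" for p
    using rr(2)[of p] that len by simp
  define \<iota> where "\<iota> = mat m d (\<lambda>(i, p). us ! p $ i / of_real (r p))"
  have \<iota>: "\<iota> \<in> carrier_mat m d" by (simp add: \<iota>_def)
  have "mat_adjoint \<iota> * \<iota> = 1\<^sub>m d"
  proof (rule eq_matI)
    fix p q assume "p < dim_row (1\<^sub>m d)" "q < dim_col (1\<^sub>m d)"
    then have pq: "p < d" "q < d" by auto
    have "(mat_adjoint \<iota> * \<iota>) $$ (p, q) = (us ! q \<bullet>c us ! p) / (of_real (r p) * of_real (r q))"
      using pq uc[OF pq(1)] by (simp add: \<iota>_def scalar_prod_def mult.commute sum_divide_distrib)
    also have "\<dots> = 1\<^sub>m d $$ (p, q)"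
      using pq rr[OF pq(1)] corthogonalD[OF gs(2), of q p] len by (cases "p = q") auto
    finally show "(mat_adjoint \<iota> * \<iota>) $$ (p, q) = 1\<^sub>m d $$ (p, q)" .
  qed (use \<iota> in auto)
  moreover have "(\<lambda>v. \<iota> *\<^sub>v v) ` carrier_vec d = mat_kernel A"
  proof -
    have eq: "\<iota> *\<^sub>v v = lincomb_list (\<lambda>p. v $ p / of_real (r p)) us" if "v \<in> carrier_vec d" for v
    proof -
      have "lincomb_list (\<lambda>p. v $ p / of_real (r p)) us =
          mat_of_cols m us *\<^sub>v vec (length us) (\<lambda>p. v $ p / of_real (r p))"
        using gs(3) by (intro lincomb_list_as_mat_mult) auto
      then show ?thesis
        using that len by (auto simp: \<iota>_def scalar_prod_def mat_of_cols_index intro!: eq_vecI sum.cong)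
    qed
    have ker: "mat_kernel A = span_list us"
      using span_us span_list_as_span[OF gs(3)] by simp
    show ?thesis
    proof (intro equalityI subsetI)
      fix w assume "w \<in> (\<lambda>v. \<iota> *\<^sub>v v) ` carrier_vec d"
      then show "w \<in> mat_kernel A" using eq by (auto simp: ker span_list_def)
    next
      fix w assume "w \<in> mat_kernel A"
      then obtain c where c: "w = lincomb_list c us" by (auto simp: ker span_list_def)
      \<comment> \<open>Multiplying the coefficients by the norms undoes the normalization of the
        columns.\<close>
      have "\<iota> *\<^sub>v vec d (\<lambda>p. of_real (r p) * c p) =
          lincomb_list (\<lambda>p. vec d (\<lambda>p. of_real (r p) * c p) $ p / of_real (r p)) us"
        by (rule eq) simp
      also have "\<dots> = w"
        unfolding c using gs(3) len r0
        by (subst (1 2) lincomb_list_as_mat_mult)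
          (auto intro!: arg_cong[of _ _ "\<lambda>v. _ *\<^sub>v v"] eq_vecI)
      finally show "w \<in> (\<lambda>v. \<iota> *\<^sub>v v) ` carrier_vec d" by (metis image_eqI vec_carrier)
    qed
  qed
  ultimately show ?thesis using \<iota> by blast
qed

text \<open>Needed to make the "for every \<iota>" and "for some \<iota>" readings of (i)
  coincide.\<close>

lemma kernel_unitary_exists:
  assumes "linear_on_mats n \<Phi>"
  shows "\<exists>\<iota>. kernel_unitary n \<Phi> \<iota>"
  using unitary_onto_kernel_exists[OF choi_carrier[OF assms]]
  by (auto simp: kernel_unitary_def kernel_dim_def)

section \<open>The three conditions\<close>

lemma braket_eq_sum: "v \<in> carrier_vec n \<Longrightarrow> u \<in> carrier_vec n \<Longrightarrow> braket u v = (\<Sum>i<n. v $ i * cnj (u $ i))"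
  by (simp add: braket_def scalar_prod_def atLeast0LessThan)

lemma outer_mult_vec:
  "u \<in> carrier_vec m \<Longrightarrow> v \<in> carrier_vec n \<Longrightarrow> w \<in> carrier_vec n \<Longrightarrow> outer u v *\<^sub>v w = braket v w \<cdot>\<^sub>v u"
  by (intro eq_vecI) (auto simp: braket_def scalar_prod_def sum_distrib_left mult_ac)

lemma smult_mat_mult_vec:
  fixes A :: "'a :: comm_ring_1 mat"
  shows "A \<in> carrier_mat m n \<Longrightarrow> v \<in> carrier_vec n \<Longrightarrow> (c \<cdot>\<^sub>m A) *\<^sub>v v = c \<cdot>\<^sub>v (A *\<^sub>v v)"
  by (intro eq_vecI) (auto simp: scalar_prod_def sum_distrib_left mult_ac)

lemma mat_mult_outer:
  "A \<in> carrier_mat k m \<Longrightarrow> u \<in> carrier_vec m \<Longrightarrow> v \<in> carrier_vec n \<Longrightarrow> A * outer u v = outer (A *\<^sub>v u) v"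
  by (intro eq_matI) (auto simp: scalar_prod_def sum_distrib_left mult_ac)

lemma mat_adjoint_outer [simp]: "mat_adjoint (outer u v) = outer v u"
  by (intro eq_matI) auto

lemma mat_adjoint_smult:
  fixes A :: "complex mat"
  shows "mat_adjoint (c \<cdot>\<^sub>m A) = cnj c \<cdot>\<^sub>m mat_adjoint A"
  by (intro eq_matI) auto

lemma braket_adjoint_mult:
  assumes "K \<in> carrier_mat n n" "G \<in> carrier_mat n n" "x \<in> carrier_vec n" "x' \<in> carrier_vec n"
  shows "braket x' ((mat_adjoint K * G) *\<^sub>v x) = braket (K *\<^sub>v x') (G *\<^sub>v x)"
proof -
  have "(mat_adjoint K * G) *\<^sub>v x = mat_adjoint K *\<^sub>v (G *\<^sub>v x)"
    using assms by (intro assoc_mult_mat_vec) auto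
  then show ?thesis
    using mult_vec_cscalar_prod[of "mat_adjoint K" n n "G *\<^sub>v x" x'] assms by (simp add: braket_def)
qed

lemma mat_trace_adjoint_outer_mult:
  assumes "u \<in> carrier_vec n" "x \<in> carrier_vec n" "G \<in> carrier_mat n n"
  shows "mat_trace (mat_adjoint (outer u x) * G) = braket u (G *\<^sub>v x)"
proof -
  have "mat_trace (mat_adjoint (outer u x) * G) = (\<Sum>j<n. \<Sum>a<n. G $$ (a, j) * x $ j * cnj (u $ a))"
    using assms by (subst mat_trace_adjoint_mult[of _ n]) (auto intro!: sum.cong)
  also have "\<dots> = (\<Sum>a<n. \<Sum>j<n. G $$ (a, j) * x $ j * cnj (u $ a))" by (rule sum.swap)
  also have "\<dots> = braket u (G *\<^sub>v x)"
    using assms by (simp add: braket_eq_sum[of _ n] scalar_prod_def atLeast0LessThan sum_distrib_right)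
  finally show ?thesis .
qed

text \<open>Under vectorization the operator \<open>(|x'><x|)\<^sup>T \<otimes> 1\<close> has adjoint \<open>G \<mapsto> G |x><x'|\<close>.\<close>
lemma adjoint_kron_mult_vectorize:
  assumes x: "x \<in> carrier_vec n" "x' \<in> carrier_vec n" and G: "G \<in> carrier_mat n n"
  shows "mat_adjoint (kron (transpose_mat (outer x' x)) (1\<^sub>m n)) *\<^sub>v vectorize n G =
    vectorize n (outer (G *\<^sub>v x) x')"
proof -
  let ?T = "kron (transpose_mat (outer x' x)) (1\<^sub>m n)"
  have O: "transpose_mat (outer x' x) \<in> carrier_mat n n" using x by simp
  have T: "?T \<in> carrier_mat (n * n) (n * n)" using O by simp
  show ?thesis
  proof (rule eq_vecI)
    fix i assume "i < dim_vec (vectorize n (outer (G *\<^sub>v x) x'))"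
    then obtain j a where i: "j < n" "a < n" "i = j * n + a" by (auto elim: less_square_cases)
    have "(mat_adjoint ?T *\<^sub>v vectorize n G) $ i = (\<Sum>i'<n * n. cnj (?T $$ (i', i)) * vectorize n G $ i')"
      using T i by (simp add: scalar_prod_def atLeast0LessThan mult_add_less_mult)
    also have "\<dots> = (\<Sum>k<n. \<Sum>b<n. if b = a then cnj (outer x' x $$ (j, k)) * G $$ (a, k) else 0)"
      unfolding sum_square using i x
      by (intro sum.cong refl) (auto simp: index_vectorize index_kron[OF O one_carrier_mat])
    also have "\<dots> = (G *\<^sub>v x) $ a * cnj (x' $ j)"
      using i x G by (simp add: scalar_prod_def atLeast0LessThan sum_distrib_left mult_ac)
    also have "\<dots> = vectorize n (outer (G *\<^sub>v x) x') $ i"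
      using i x G by (simp add: index_vectorize)
    finally show "(mat_adjoint ?T *\<^sub>v vectorize n G) $ i = vectorize n (outer (G *\<^sub>v x) x') $ i" .
  qed (use T in auto)
qed

text \<open>By \<open>adjoint_kron_mult_vectorize\<close> the inner vector is the vectorization of
  G|x><x'|, and its Hilbert-Schmidt product with \<open>Ks ! l\<close> is the number occurring in
  (iii).\<close>

lemma index_adjoint_kraus_mat_kron:
  assumes x: "x \<in> carrier_vec n" "x' \<in> carrier_vec n" and G: "G \<in> carrier_mat n n"
    and Ks: "set Ks \<subseteq> carrier_mat n n" and l: "l < length Ks"
  shows "(mat_adjoint (kraus_mat n Ks) *\<^sub>v
      (mat_adjoint (kron (transpose_mat (outer x' x)) (1\<^sub>m n)) *\<^sub>v vectorize n G)) $ l =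
    braket x' ((mat_adjoint (Ks ! l) * G) *\<^sub>v x)"
proof -
  have K: "Ks ! l \<in> carrier_mat n n" using Ks nth_mem[OF l] by blast
  have "(mat_adjoint (kraus_mat n Ks) *\<^sub>v vectorize n (outer (G *\<^sub>v x) x')) $ l =
      (\<Sum>j<n. \<Sum>a<n. cnj (Ks ! l $$ (a, j)) * outer (G *\<^sub>v x) x' $$ (a, j))"
    using l by (simp add: index_adjoint_kraus_mat_mult_vec index_vectorize del: index_outer(1) index_mult_mat_vec)
  also have "\<dots> = (\<Sum>j<n. \<Sum>a<n. cnj (Ks ! l $$ (a, j)) * (G *\<^sub>v x) $ a * cnj (x' $ j))"
    using x G by (intro sum.cong refl) simp
  also have "\<dots> = (\<Sum>a<n. \<Sum>j<n. cnj (Ks ! l $$ (a, j)) * (G *\<^sub>v x) $ a * cnj (x' $ j))"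
    by (rule sum.swap)
  also have "\<dots> = braket (Ks ! l *\<^sub>v x') (G *\<^sub>v x)"
    using x G K by (simp add: braket_eq_sum[of _ n] scalar_prod_def atLeast0LessThan
        sum_distrib_left mult_ac del: index_mult_mat_vec) (simp add: scalar_prod_def atLeast0LessThan
        sum_distrib_left mult_ac)
  finally show ?thesis
    using x G K by (simp add: adjoint_kron_mult_vectorize braket_adjoint_mult)
qed

text \<open>Writing the Choi matrix as V times its adjoint turns the product in (i) into
  \<open>mat_adjoint W * W\<close>, so (i) says \<open>W\<close> = 0. Since \<iota> maps onto the
  kernel of the Choi matrix, that means that \<open>mat_adjoint V * mat_adjoint T\<close>
  annihilates the vectorized complement.\<close>

lemma choi_condition_iff:
  assumes lin: "linear_on_mats n \<Phi>" and kr: "kraus_operators n \<Phi> Ks"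
    and x: "x \<in> carrier_vec n" "x' \<in> carrier_vec n" and \<iota>: "kernel_unitary n \<Phi> \<iota>"
  shows "choi_condition n \<Phi> x x' \<iota> \<longleftrightarrow>
    (\<forall>K\<in>set Ks. \<forall>G\<in>kraus_perp n \<Phi>. braket x' ((mat_adjoint K * G) *\<^sub>v x) = 0)"
proof -
  define d where "d = kernel_dim n \<Phi>"
  define T where "T = kron (transpose_mat (outer x' x)) (1\<^sub>m n)"
  define V where "V = kraus_mat n Ks"
  define W where "W = mat_adjoint V * (mat_adjoint T * \<iota>)"
  have Ks: "set Ks \<subseteq> carrier_mat n n" using kr by (simp add: kraus_operators_def)
  have ic: "\<iota> \<in> carrier_mat (n * n) d"
    and im: "(\<lambda>v. \<iota> *\<^sub>v v) ` carrier_vec d = mat_kernel (choi n \<Phi>)"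
    using \<iota> by (auto simp: kernel_unitary_def d_def)
  have T: "T \<in> carrier_mat (n * n) (n * n)" using x by (simp add: T_def)
  have V: "V \<in> carrier_mat (n * n) (length Ks)" by (simp add: V_def)
  have W: "W \<in> carrier_mat (length Ks) d"
    unfolding W_def using T V ic by (intro mult_carrier_mat[of _ _ "n * n"]) auto
  have perp: "kraus_perp n \<Phi> = {G \<in> carrier_mat n n. vectorize n G \<in> mat_kernel (choi n \<Phi>)}"
    using mem_kraus_perp_iff[OF lin] kr by auto
  have W': "mat_adjoint W = mat_adjoint \<iota> * T * V"
  proof -
    have "mat_adjoint W = mat_adjoint (mat_adjoint T * \<iota>) * V"
      unfolding W_def using T V ic by (subst mat_adjoint_mult[of _ _ "n * n" _ d]) auto
    also have "mat_adjoint (mat_adjoint T * \<iota>) = mat_adjoint \<iota> * T"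
      using T ic by (subst mat_adjoint_mult[of _ _ "n * n" _ d]) auto
    finally show ?thesis .
  qed
  \<comment> \<open>Insert the factorization of the Choi matrix and regroup around its
    middle.\<close>
  have "mat_adjoint \<iota> * T * choi n \<Phi> * mat_adjoint T * \<iota> = mat_adjoint W * W"
  proof -
    have iT: "mat_adjoint \<iota> * T \<in> carrier_mat d (n * n)"
      using T ic by (intro mult_carrier_mat[of _ _ "n * n"]) auto
    have V': "mat_adjoint V \<in> carrier_mat (length Ks) (n * n)" using V by simp
    have T': "mat_adjoint T \<in> carrier_mat (n * n) (n * n)" using T by simp
    have iTV: "mat_adjoint \<iota> * T * V \<in> carrier_mat d (length Ks)"
      using iT V by (rule mult_carrier_mat)
    have "mat_adjoint \<iota> * T * choi n \<Phi> = mat_adjoint \<iota> * T * V * mat_adjoint V"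
      using kr iT V V' by (simp add: kraus_operators_iff_choi[OF lin Ks] V_def[symmetric]
          assoc_mult_mat[of _ d "n * n" _ "length Ks" _ "n * n"])
    then have "mat_adjoint \<iota> * T * choi n \<Phi> * mat_adjoint T * \<iota> =
        mat_adjoint \<iota> * T * V * mat_adjoint V * mat_adjoint T * \<iota>" by simp
    also have "\<dots> = mat_adjoint \<iota> * T * V * (mat_adjoint V * mat_adjoint T) * \<iota>"
      using assoc_mult_mat[OF iTV V' T'] by simp
    also have "\<dots> = mat_adjoint \<iota> * T * V * (mat_adjoint V * mat_adjoint T * \<iota>)"
      by (rule assoc_mult_mat[OF iTV mult_carrier_mat[OF V' T'] ic])
    also have "\<dots> = mat_adjoint W * W"
      using assoc_mult_mat[OF V' T' ic] by (simp add: W' W_def[symmetric])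
    finally show ?thesis .
  qed
  then have "choi_condition n \<Phi> x x' \<iota> \<longleftrightarrow> mat_adjoint W * W = 0\<^sub>m d d"
    by (simp add: choi_condition_def T_def d_def Let_def)
  also have "\<dots> \<longleftrightarrow> (\<forall>v\<in>carrier_vec d. W *\<^sub>v v = 0\<^sub>v (length Ks))"
    using gram_eq_0_iff[OF W] mat_eq_0_iff_mult_vec[OF W] by simp
  also have "\<dots> \<longleftrightarrow> (\<forall>v\<in>carrier_vec d. mat_adjoint V *\<^sub>v (mat_adjoint T *\<^sub>v (\<iota> *\<^sub>v v)) = 0\<^sub>v (length Ks))"
  proof (intro ball_cong refl)
    fix v :: "complex vec" assume v: "v \<in> carrier_vec d"
    have "W *\<^sub>v v = mat_adjoint V *\<^sub>v ((mat_adjoint T * \<iota>) *\<^sub>v v)"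
      unfolding W_def using V T ic v by (intro assoc_mult_mat_vec[of _ _ "n * n" _ d]) auto
    also have "(mat_adjoint T * \<iota>) *\<^sub>v v = mat_adjoint T *\<^sub>v (\<iota> *\<^sub>v v)"
      using T ic v by (intro assoc_mult_mat_vec[of _ _ "n * n" _ d]) auto
    finally show "(W *\<^sub>v v = 0\<^sub>v (length Ks)) =
      (mat_adjoint V *\<^sub>v (mat_adjoint T *\<^sub>v (\<iota> *\<^sub>v v)) = 0\<^sub>v (length Ks))" by simp
  qed
  also have "\<dots> \<longleftrightarrow> (\<forall>g\<in>mat_kernel (choi n \<Phi>). mat_adjoint V *\<^sub>v (mat_adjoint T *\<^sub>v g) = 0\<^sub>v (length Ks))"
    unfolding im[symmetric] by simp
  also have "\<dots> \<longleftrightarrow> (\<forall>G\<in>kraus_perp n \<Phi>.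
      mat_adjoint V *\<^sub>v (mat_adjoint T *\<^sub>v vectorize n G) = 0\<^sub>v (length Ks))"
  proof -
    \<comment> \<open>Vectorization is onto the kernel, so quantifying over kernel vectors is
      quantifying over the complement.\<close>
    have "mat_kernel (choi n \<Phi>) = vectorize n ` kraus_perp n \<Phi>"
    proof (intro equalityI subsetI)
      fix g assume g: "g \<in> mat_kernel (choi n \<Phi>)"
      then have "g \<in> carrier_vec (n * n)" using mat_kernel_carrier[OF choi_carrier[OF lin]] by blast
      then have "vectorize n (unvectorize n g) = g" by (rule vectorize_unvectorize)
      with g show "g \<in> vectorize n ` kraus_perp n \<Phi>"
        by (intro image_eqI[of _ _ "unvectorize n g"]) (auto simp: perp)
    qed (auto simp: perp)
    then show ?thesis by simp
  qed
  also have "\<dots> \<longleftrightarrow> (\<forall>G\<in>kraus_perp n \<Phi>. \<forall>K\<in>set Ks. braket x' ((mat_adjoint K * G) *\<^sub>v x) = 0)"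
  proof (intro ball_cong refl)
    fix G assume "G \<in> kraus_perp n \<Phi>"
    then have "G \<in> carrier_mat n n" by (simp add: kraus_perp_def)
    from index_adjoint_kraus_mat_kron[OF x this Ks]
    show "(mat_adjoint V *\<^sub>v (mat_adjoint T *\<^sub>v vectorize n G) = 0\<^sub>v (length Ks)) =
      (\<forall>K\<in>set Ks. braket x' ((mat_adjoint K * G) *\<^sub>v x) = 0)"
      by (auto simp: all_set_conv_all_nth vec_eq_iff V_def T_def simp del: index_mult_mat_vec)
  qed
  also have "\<dots> \<longleftrightarrow> (\<forall>K\<in>set Ks. \<forall>G\<in>kraus_perp n \<Phi>. braket x' ((mat_adjoint K * G) *\<^sub>v x) = 0)"
    by blast
  finally show ?thesis .
qed

text \<open>The columns of \<open>W\<close> are the vectors K|x'>, so \<Phi>(|x'><x'|) is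
  \<open>W * mat_adjoint W\<close> and \<open>gram_mult_vec_eq_0_iff\<close> cancels the outer
  factor. The left side does not mention \<open>Ks\<close>, which makes the right side independent
  of the chosen Kraus family.\<close>

lemma channel_condition_iff:
  assumes kr: "kraus_operators n \<Phi> Ks"
    and x: "x \<in> carrier_vec n" "x' \<in> carrier_vec n"
  shows "channel_condition n \<Phi> x x' \<longleftrightarrow>
    (\<forall>K\<in>set Ks. \<forall>G\<in>kraus_perp n \<Phi>. braket x' ((mat_adjoint K * G) *\<^sub>v x) = 0)"
proof -
  define W where "W = mat n (length Ks) (\<lambda>(a, l). (Ks ! l *\<^sub>v x') $ a)"
  have Ks: "set Ks \<subseteq> carrier_mat n n" using kr by (simp add: kraus_operators_def)
  have K: "Ks ! l \<in> carrier_mat n n" if "l < length Ks" for l using Ks nth_mem[OF that] by blast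
  have W: "W \<in> carrier_mat n (length Ks)" by (simp add: W_def)
  have summand: "Ks ! l * outer x' x' * mat_adjoint (Ks ! l) = outer (Ks ! l *\<^sub>v x') (Ks ! l *\<^sub>v x')"
    if "l < length Ks" for l
  proof -
    have Kx: "Ks ! l *\<^sub>v x' \<in> carrier_vec n" using K[OF that] x by simp
    have "Ks ! l * outer x' x' * mat_adjoint (Ks ! l) = outer (Ks ! l *\<^sub>v x') x' * mat_adjoint (Ks ! l)"
      using x K[OF that] by (simp add: mat_mult_outer)
    also have "\<dots> = mat_adjoint (Ks ! l * outer x' (Ks ! l *\<^sub>v x'))"
      using x Kx K[OF that] by (subst mat_adjoint_mult[of _ n n _ n]) auto
    also have "\<dots> = outer (Ks ! l *\<^sub>v x') (Ks ! l *\<^sub>v x')"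
      using mat_mult_outer[OF K[OF that] x(2) Kx] by simp
    finally show ?thesis .
  qed
  have \<Phi>: "\<Phi> (outer x' x') = W * mat_adjoint W"
  proof -
    have f: "(\<lambda>l. Ks ! l * outer x' x' * mat_adjoint (Ks ! l)) \<in> {..<length Ks} \<rightarrow> carrier_mat n n"
      using K x by (auto intro!: mult_carrier_mat[of _ n n])
    have "\<Phi> (outer x' x') = finsum (cmats n) (\<lambda>l. Ks ! l * outer x' x' * mat_adjoint (Ks ! l)) {..<length Ks}"
      using kr x by (simp add: kraus_operators_def)
    also have "\<dots> = W * mat_adjoint W"
    proof (rule eq_matI)
      fix a b assume "a < dim_row (W * mat_adjoint W)" "b < dim_col (W * mat_adjoint W)"
      then have ab: "a < n" "b < n" using W by auto
      have "finsum (cmats n) (\<lambda>l. Ks ! l * outer x' x' * mat_adjoint (Ks ! l)) {..<length Ks} $$ (a, b) =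
          (\<Sum>l<length Ks. (Ks ! l * outer x' x' * mat_adjoint (Ks ! l)) $$ (a, b))"
        using f ab by (intro finsum_mat_closed_index) auto
      also have "\<dots> = (\<Sum>l<length Ks. W $$ (a, l) * cnj (W $$ (b, l)))"
      proof (intro sum.cong refl)
        fix l assume "l \<in> {..<length Ks}"
        then show "(Ks ! l * outer x' x' * mat_adjoint (Ks ! l)) $$ (a, b) = W $$ (a, l) * cnj (W $$ (b, l))"
          using ab K[of l] by (auto simp: summand W_def)
      qed
      also have "\<dots> = (W * mat_adjoint W) $$ (a, b)"
        using ab W by (simp add: scalar_prod_def atLeast0LessThan)
      finally show "finsum (cmats n) (\<lambda>l. Ks ! l * outer x' x' * mat_adjoint (Ks ! l)) {..<length Ks} $$ (a, b) =
          (W * mat_adjoint W) $$ (a, b)" .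
    qed (use W finsum_mat_closed_index(1)[OF f] in auto)
    finally show ?thesis .
  qed
  have "(\<Phi> (outer x' x') * G) *\<^sub>v x = 0\<^sub>v n \<longleftrightarrow>
      (\<forall>K\<in>set Ks. braket x' ((mat_adjoint K * G) *\<^sub>v x) = 0)" if "G \<in> kraus_perp n \<Phi>" for G
  proof -
    have G: "G \<in> carrier_mat n n" using that by (simp add: kraus_perp_def)
    have y: "G *\<^sub>v x \<in> carrier_vec n" using G x by simp
    have "(\<Phi> (outer x' x') * G) *\<^sub>v x = (W * mat_adjoint W) *\<^sub>v (G *\<^sub>v x)"
      unfolding \<Phi> using W G x by (intro assoc_mult_mat_vec[of _ n n]) auto
    then have "(\<Phi> (outer x' x') * G) *\<^sub>v x = 0\<^sub>v n \<longleftrightarrow> mat_adjoint W *\<^sub>v (G *\<^sub>v x) = 0\<^sub>v (length Ks)"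
      using gram_mult_vec_eq_0_iff[OF W y] by simp
    moreover have "(mat_adjoint W *\<^sub>v (G *\<^sub>v x)) $ l = braket x' ((mat_adjoint (Ks ! l) * G) *\<^sub>v x)"
      if "l < length Ks" for l
    proof -
      have "(mat_adjoint W *\<^sub>v v) $ l = (\<Sum>a<n. cnj (W $$ (a, l)) * v $ a)"
        if "v \<in> carrier_vec n" for v
        using that W \<open>l < length Ks\<close> by (simp add: scalar_prod_def atLeast0LessThan)
      from this[OF y] have "(mat_adjoint W *\<^sub>v (G *\<^sub>v x)) $ l =
          (\<Sum>a<n. cnj ((Ks ! l *\<^sub>v x') $ a) * (G *\<^sub>v x) $ a)"
        using that by (simp add: W_def del: index_mult_mat_vec(1))
      then show ?thesis
        using that K[OF that] G x y
        by (simp add: braket_adjoint_mult braket_eq_sum[of _ n] mult.commute del: index_mult_mat_vec(1))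
    qed
    ultimately show ?thesis
      using W by (auto simp: all_set_conv_all_nth vec_eq_iff simp del: index_mult_mat_vec(1))
  qed
  then show ?thesis unfolding channel_condition_def by blast
qed

text \<open>Two reductions: from all Kraus families to the given one, and from all of the complement
  to a basis.\<close>

lemma kraus_condition_iff:
  assumes lin: "linear_on_mats n \<Phi>" and kr: "kraus_operators n \<Phi> Ks"
    and x: "x \<in> carrier_vec n" "x' \<in> carrier_vec n"
  shows "kraus_condition n \<Phi> x x' \<longleftrightarrow>
    (\<forall>K\<in>set Ks. \<forall>G\<in>kraus_perp n \<Phi>. braket x' ((mat_adjoint K * G) *\<^sub>v x) = 0)"
proof
  let ?P = "(cmats n)\<lparr>carrier := kraus_perp n \<Phi>\<rparr>"
  interpret M: matrix_vs n n "TYPE(complex)" .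
  have sub: "submodule class_ring (kraus_perp n \<Phi>) (cmats n)"
    using lin kr by (intro submodule_kraus_perp) auto
  interpret P: vectorspace class_ring ?P
    using sub M.vectorspace_axioms by (intro M.subspace_is_vs VectorSpace.subspace.intro)
  show "kraus_condition n \<Phi> x x'"
    if "\<forall>K\<in>set Ks. \<forall>G\<in>kraus_perp n \<Phi>. braket x' ((mat_adjoint K * G) *\<^sub>v x) = 0"
    unfolding kraus_condition_def
  proof clarify
    fix Ks' Gs K G
    assume "kraus_operators n \<Phi> Ks'" "P.basis Gs" "K \<in> set Ks'" "G \<in> Gs"
    moreover from this have "G \<in> kraus_perp n \<Phi>" by (auto simp: P.basis_def)
    \<comment> \<open>Passing through \<open>channel_condition\<close> exchanges \<open>Ks\<close>
      for \<open>Ks'\<close>.\<close>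
    ultimately show "braket x' ((mat_adjoint K * G) *\<^sub>v x) = 0"
      using that x by (simp add: channel_condition_iff[OF kr x, symmetric] channel_condition_iff)
  qed
  assume cond: "kraus_condition n \<Phi> x x'"
  obtain Gs where Gs: "P.basis Gs" using kraus_perp_basis_exists[OF lin] kr by blast
  show "\<forall>K\<in>set Ks. \<forall>G\<in>kraus_perp n \<Phi>. braket x' ((mat_adjoint K * G) *\<^sub>v x) = 0"
  proof
    fix K assume K: "K \<in> set Ks"
    then have Kc: "K \<in> carrier_mat n n" using kr by (auto simp: kraus_operators_def)
    \<comment> \<open>For fixed \<open>K\<close> the bracket is linear in \<open>G\<close>, so its
      zero set is a subspace; it contains the basis and therefore its span.\<close>
    let ?N = "{G \<in> carrier_mat n n. braket (K *\<^sub>v x') (G *\<^sub>v x) = 0}"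
    have "0\<^sub>m n n *\<^sub>v x = 0\<^sub>v n" using x by (intro eq_vecI) auto
    then have "submodule class_ring ?N (cmats n)"
      using Kc x by (intro submodule_matI)
        (auto simp: braket_eq_sum[of _ n] add_mult_distrib_mat_vec[of _ n n] distrib_right sum.distrib
          smult_mat_mult_vec[of _ n n] mult.assoc
          simp del: index_mult_mat_vec(1) simp flip: sum_distrib_left)
    moreover have "Gs \<subseteq> ?N"
    proof
      fix G assume "G \<in> Gs"
      then have "G \<in> carrier_mat n n" "braket x' ((mat_adjoint K * G) *\<^sub>v x) = 0"
        using Gs cond kr K unfolding P.basis_def kraus_condition_def by (auto simp: kraus_perp_def)
      then show "G \<in> ?N" using Kc x by (simp add: braket_adjoint_mult)
    qed
    ultimately have "M.span Gs \<subseteq> ?N" by (intro M.span_is_subset)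
    \<comment> \<open>The span of a subset of a subspace is the same taken inside the subspace or in
      all matrices.\<close>
    moreover have "M.span Gs = kraus_perp n \<Phi>"
      using Gs M.span_li_not_depend(1)[OF _ sub, of Gs] by (simp add: P.basis_def)
    ultimately show "\<forall>G\<in>kraus_perp n \<Phi>. braket x' ((mat_adjoint K * G) *\<^sub>v x) = 0"
      using Kc x by (auto simp: braket_adjoint_mult[of K n])
  qed
qed

section \<open>Factoring a channel through Psi\<close>

lemma index_kraus_finsum:
  assumes "set Ks \<subseteq> carrier_mat n n" "X \<in> carrier_mat n n" "a < n" "b < n"
  shows "finsum (cmats n) (\<lambda>l. Ks ! l * X * mat_adjoint (Ks ! l)) {..<length Ks} $$ (a, b) =
    (\<Sum>K\<leftarrow>Ks. (K * X * mat_adjoint K) $$ (a, b))"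
proof -
  have "(\<lambda>l. Ks ! l * X * mat_adjoint (Ks ! l)) \<in> {..<length Ks} \<rightarrow> carrier_mat n n"
    using assms by (auto intro!: mult_carrier_mat[of _ n n] dest: nth_mem)
  then show ?thesis
    using assms by (subst finsum_mat_closed_index) (auto simp: sum_list_sum_nth atLeast0LessThan)
qed

text \<open>With list sums of entries, appending two families of operators becomes addition, as
  \<open>kraus_operators_comp\<close> requires.\<close>

lemma kraus_operators_iff_index:
  assumes lin: "linear_on_mats n \<Phi>"
  shows "kraus_operators n \<Phi> Ks \<longleftrightarrow> set Ks \<subseteq> carrier_mat n n \<and>
    (\<forall>X\<in>carrier_mat n n. \<forall>a<n. \<forall>b<n. \<Phi> X $$ (a, b) = (\<Sum>K\<leftarrow>Ks. (K * X * mat_adjoint K) $$ (a, b)))"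
proof (cases "set Ks \<subseteq> carrier_mat n n")
  case Ks: True
  have "\<Phi> X = finsum (cmats n) (\<lambda>l. Ks ! l * X * mat_adjoint (Ks ! l)) {..<length Ks} \<longleftrightarrow>
      (\<forall>a<n. \<forall>b<n. \<Phi> X $$ (a, b) = (\<Sum>K\<leftarrow>Ks. (K * X * mat_adjoint K) $$ (a, b)))"
    (is "_ = ?S \<longleftrightarrow> _") if X: "X \<in> carrier_mat n n" for X
  proof -
    have "?S \<in> carrier_mat n n"
      using Ks X by (intro finsum_mat_closed_index) (auto intro!: mult_carrier_mat[of _ n n] dest: nth_mem)
    then show ?thesis
      using linear_on_mats_closed[OF lin X] by (auto simp: mat_eq_iff index_kraus_finsum[OF Ks X])
  qed
  then show ?thesis using Ks by (simp add: kraus_operators_def)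
qed (simp add: kraus_operators_def)

lemma mult_conj_assoc:
  fixes M K X :: "complex mat"
  assumes "M \<in> carrier_mat n n" "K \<in> carrier_mat n n" "X \<in> carrier_mat n n"
  shows "(M * K) * X * mat_adjoint (M * K) = M * (K * X * mat_adjoint K) * mat_adjoint M"
proof -
  have ad: "mat_adjoint M \<in> carrier_mat n n" "mat_adjoint K \<in> carrier_mat n n"
    using assms by simp_all
  have "(M * K) * X * mat_adjoint (M * K) = M * (K * X) * (mat_adjoint K * mat_adjoint M)"
    using assms by (simp add: mat_adjoint_mult[of _ n n _ n] assoc_mult_mat[of _ n n _ n _ n])
  also have "\<dots> = M * (K * X) * mat_adjoint K * mat_adjoint M"
    using assms ad by (intro assoc_mult_mat[symmetric, of _ n n _ n _ n] mult_carrier_mat[of _ n n])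
  also have "M * (K * X) * mat_adjoint K = M * (K * X * mat_adjoint K)"
    using assms ad by (intro assoc_mult_mat[of _ n n _ n _ n] mult_carrier_mat[of _ n n])
  finally show ?thesis .
qed

text \<open>Distributing each \<open>M\<close> over the two inner terms and regrouping shows that
  the Kraus operators of a composition are the pairwise products.\<close>

lemma kraus_operators_comp:
  assumes \<Lambda>: "linear_on_mats n \<Lambda>" and Ms: "kraus_operators n \<Lambda> Ms"
    and \<Phi>: "linear_on_mats n \<Phi>"
    and KL: "K \<in> carrier_mat n n" "L \<in> carrier_mat n n"
    and comp: "\<And>X. X \<in> carrier_mat n n \<Longrightarrow> \<Phi> X = \<Lambda> (K * X * mat_adjoint K + L * X * mat_adjoint L)"
  shows "kraus_operators n \<Phi> (map (\<lambda>M. M * K) Ms @ map (\<lambda>M. M * L) Ms)"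
  unfolding kraus_operators_iff_index[OF \<Phi>]
proof (intro conjI ballI allI impI)
  have Msc: "set Ms \<subseteq> carrier_mat n n" using Ms by (simp add: kraus_operators_def)
  show "set (map (\<lambda>M. M * K) Ms @ map (\<lambda>M. M * L) Ms) \<subseteq> carrier_mat n n"
    using Msc KL by (auto intro!: mult_carrier_mat[of _ n n])
  fix X :: "complex mat" and a b assume X: "X \<in> carrier_mat n n" and ab: "a < n" "b < n"
  let ?K = "K * X * mat_adjoint K" and ?L = "L * X * mat_adjoint L"
  have c: "?K \<in> carrier_mat n n" "?L \<in> carrier_mat n n"
    using KL X by (auto intro!: mult_carrier_mat[of _ n n])
  have "\<Phi> X $$ (a, b) = (\<Sum>M\<leftarrow>Ms. (M * (?K + ?L) * mat_adjoint M) $$ (a, b))"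
    using Ms ab c by (simp add: comp[OF X] kraus_operators_iff_index[OF \<Lambda>])
  also have "\<dots> = (\<Sum>M\<leftarrow>Ms. ((M * K) * X * mat_adjoint (M * K)) $$ (a, b) +
      ((M * L) * X * mat_adjoint (M * L)) $$ (a, b))"
  proof (intro arg_cong[of _ _ sum_list] map_cong refl)
    fix M assume "M \<in> set Ms"
    then have M: "M \<in> carrier_mat n n" using Msc by blast
    then have M': "mat_adjoint M \<in> carrier_mat n n" by simp
    have cc: "M * ?K \<in> carrier_mat n n" "M * ?L \<in> carrier_mat n n"
      "M * ?K * mat_adjoint M \<in> carrier_mat n n" "M * ?L * mat_adjoint M \<in> carrier_mat n n"
      using M M' c by (auto intro!: mult_carrier_mat[of _ n n])
    have "M * (?K + ?L) * mat_adjoint M = M * ?K * mat_adjoint M + M * ?L * mat_adjoint M"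
      using mult_add_distrib_mat[OF M c] add_mult_distrib_mat[OF cc(1,2) M'] by simp
    then show "(M * (?K + ?L) * mat_adjoint M) $$ (a, b) =
        ((M * K) * X * mat_adjoint (M * K)) $$ (a, b) + ((M * L) * X * mat_adjoint (M * L)) $$ (a, b)"
      unfolding mult_conj_assoc[OF M KL(1) X] mult_conj_assoc[OF M KL(2) X]
      using ab cc(4) by (auto simp del: index_mult_mat(1))
  qed
  also have "\<dots> = (\<Sum>N\<leftarrow>map (\<lambda>M. M * K) Ms @ map (\<lambda>M. M * L) Ms. (N * X * mat_adjoint N) $$ (a, b))"
    by (simp add: sum_list_addf o_def)
  finally show "\<Phi> X $$ (a, b) = \<dots>" .
qed

text \<open>The actions on \<open>x\<close> serve the injectivity of \<open>Psi\<close>; those on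
  \<open>y\<close> serve the evaluation of the Kraus operators of \<Phi> at
  \<open>y\<close>.\<close>

lemma Psi_kraus:
  fixes l :: real and n :: nat and x y :: "complex vec"
  defines "K \<equiv> 1\<^sub>m n - complex_of_real (1 - sqrt (1 - l)) \<cdot>\<^sub>m outer x x"
    and "L \<equiv> complex_of_real (sqrt l) \<cdot>\<^sub>m outer y x"
  assumes x: "x \<in> carrier_vec n" "braket x x = 1" and y: "y \<in> carrier_vec n" "braket x y = 0"
  shows "Psi n l x y X = K * X * mat_adjoint K + L * X * mat_adjoint L"
    and "K \<in> carrier_mat n n" and "L \<in> carrier_mat n n" and "mat_adjoint K = K"
    and "K *\<^sub>v x = complex_of_real (sqrt (1 - l)) \<cdot>\<^sub>v x" and "K *\<^sub>v y = y" and "L *\<^sub>v y = 0\<^sub>v n"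
    and "mat_adjoint L *\<^sub>v x = 0\<^sub>v n"
proof -
  define c where "c = complex_of_real (1 - sqrt (1 - l))"
  have O: "outer x x \<in> carrier_mat n n" "outer y x \<in> carrier_mat n n" "outer x y \<in> carrier_mat n n"
    using x y by simp_all
  have yx: "braket y x = 0"
    using y(2) x(1) y(1) conjugate_vec_sprod_comm[of x n y]
    by (metis braket_def complex_cnj_zero_iff conjugate_complex_def conjugate_conjugate_sprod)
  show "Psi n l x y X = K * X * mat_adjoint K + L * X * mat_adjoint L"
    by (simp add: Psi_def K_def L_def Let_def)
  show K: "K \<in> carrier_mat n n" and "L \<in> carrier_mat n n"
    using O unfolding K_def L_def by (simp_all add: minus_carrier_mat)
  show "mat_adjoint K = K"
    using x unfolding K_def by (intro eq_matI) auto
  have Kv: "K *\<^sub>v v = v - (c * braket x v) \<cdot>\<^sub>v x" if "v \<in> carrier_vec n" for v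
    using that x O unfolding K_def c_def[symmetric]
    by (subst minus_mult_distrib_mat_vec[of _ n n])
      (auto simp: smult_mat_mult_vec[of _ n n] outer_mult_vec[of _ n _ n] smult_smult_assoc)
  show "K *\<^sub>v x = complex_of_real (sqrt (1 - l)) \<cdot>\<^sub>v x"
    using x by (simp add: Kv) (auto simp: c_def algebra_simps intro!: eq_vecI)
  show "K *\<^sub>v y = y" using x y by (simp add: Kv) (auto intro!: eq_vecI)
  show "L *\<^sub>v y = 0\<^sub>v n"
    using x y O unfolding L_def
    by (auto simp: smult_mat_mult_vec[of _ n n] outer_mult_vec[of _ n _ n] intro!: eq_vecI)
  show "mat_adjoint L *\<^sub>v x = 0\<^sub>v n"
    using x y O yx unfolding L_def
    by (auto simp: mat_adjoint_smult smult_mat_mult_vec[of _ n n] outer_mult_vec[of _ n _ n] intro!: eq_vecI)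
qed

section \<open>Injectivity of \<open>Psi\<close> and the necessary condition\<close>

lemma add_right_imp_eq_mat:
  fixes A B C :: "'a :: cancel_semigroup_add mat"
  assumes "A + C = B + C" "A \<in> carrier_mat m n" "B \<in> carrier_mat m n" "C \<in> carrier_mat m n"
  shows "A = B"
proof (rule eq_matI)
  fix i j assume ij: "i < dim_row B" "j < dim_col B"
  have "(A + C) $$ (i, j) = (B + C) $$ (i, j)" by (simp only: assms(1))
  then show "A $$ (i, j) = B $$ (i, j)" using ij assms(2-4) by simp
qed (use assms(2,3) in auto)

text \<open>This is what lets \<open>inv_into\<close> undo \<open>Psi\<close>. The image of X
  determines <x|X|x>, which already fixes the term with \<open>L\<close>; the remaining term is
  conjugation by the invertible \<open>K\<close>.\<close>

lemma inj_on_Psi: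
  assumes l: "l < 1" and x: "x \<in> carrier_vec n" "braket x x = 1" and y: "y \<in> carrier_vec n" "braket x y = 0"
  shows "inj_on (Psi n l x y) (carrier_mat n n)"
proof (rule inj_onI)
  define s where "s = complex_of_real (sqrt (1 - l))"
  define K where "K = 1\<^sub>m n - complex_of_real (1 - sqrt (1 - l)) \<cdot>\<^sub>m outer x x"
  define L where "L = complex_of_real (sqrt l) \<cdot>\<^sub>m outer y x"
  note P = Psi_kraus[OF x y, of l, folded K_def L_def s_def]
  have s: "s \<noteq> 0" using l by (simp add: s_def)
  \<comment> \<open>The term with \<open>L\<close> sees X only through the number <x|X|x>.\<close>
  have LX: "L * X * mat_adjoint L = complex_of_real (sqrt l) \<cdot>\<^sub>m
      outer (complex_of_real (sqrt l) \<cdot>\<^sub>v (braket x (X *\<^sub>v x) \<cdot>\<^sub>v y)) y" if X: "X \<in> carrier_mat n n" for X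
  proof -
    have O: "outer x y \<in> carrier_mat n n" "outer y x \<in> carrier_mat n n" using x y by simp_all
    have adL: "mat_adjoint L = complex_of_real (sqrt l) \<cdot>\<^sub>m outer x y"
      by (simp add: L_def mat_adjoint_smult)
    have LX: "L * X \<in> carrier_mat n n" using P(3) X by (rule mult_carrier_mat)
    have "L * X * mat_adjoint L = complex_of_real (sqrt l) \<cdot>\<^sub>m (L * X * outer x y)"
      using mult_smult_distrib[OF LX O(1)] by (simp add: adL)
    also have "L * X * outer x y = outer (L *\<^sub>v (X *\<^sub>v x)) y"
      using mat_mult_outer[OF LX x(1) y(1)] assoc_mult_mat_vec[OF P(3) X x(1)] by simp
    also have "L *\<^sub>v (X *\<^sub>v x) = complex_of_real (sqrt l) \<cdot>\<^sub>v (braket x (X *\<^sub>v x) \<cdot>\<^sub>v y)"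
      using X x y O by (simp add: L_def smult_mat_mult_vec[of _ n n] outer_mult_vec[of _ n _ n])
    finally show ?thesis .
  qed
  \<comment> \<open>\<open>mat_adjoint L\<close> kills \<open>x\<close>, and each of the two factors
    \<open>K\<close> contributes its eigenvalue \<open>s\<close> at \<open>x\<close>.\<close>
  have diag: "braket x (Psi n l x y X *\<^sub>v x) = s * s * braket x (X *\<^sub>v x)" if X: "X \<in> carrier_mat n n" for X
  proof -
    have c: "K * X \<in> carrier_mat n n" "L * X \<in> carrier_mat n n" "mat_adjoint L \<in> carrier_mat n n"
      "K * X * K \<in> carrier_mat n n" "L * X * mat_adjoint L \<in> carrier_mat n n" "X *\<^sub>v x \<in> carrier_vec n"
      using P(2,3) X x(1) by (auto intro!: mult_carrier_mat[of _ n n])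
    have 1: "(L * X * mat_adjoint L) *\<^sub>v x = 0\<^sub>v n"
      using c assoc_mult_mat_vec[OF c(2,3) x(1)] P(8)
      by (auto simp: scalar_prod_def intro!: eq_vecI)
    have 2: "(K * X * K) *\<^sub>v x = s \<cdot>\<^sub>v (K *\<^sub>v (X *\<^sub>v x))"
    proof -
      have "(K * X * K) *\<^sub>v x = (K * X) *\<^sub>v (s \<cdot>\<^sub>v x)"
        using assoc_mult_mat_vec[OF c(1) P(2) x(1)] P(5) by simp
      also have "\<dots> = s \<cdot>\<^sub>v ((K * X) *\<^sub>v x)" by (rule mult_mat_vec[OF c(1) x(1)])
      also have "(K * X) *\<^sub>v x = K *\<^sub>v (X *\<^sub>v x)" by (rule assoc_mult_mat_vec[OF P(2) X x(1)])
      finally show ?thesis .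
    qed
    have 3: "braket x (K *\<^sub>v (X *\<^sub>v x)) = s * braket x (X *\<^sub>v x)"
      using mult_vec_cscalar_prod[OF P(2) c(6) x(1)] c(6) x(1)
      by (simp add: braket_def P(4,5) conjugate_smult_vec s_def)
    have "Psi n l x y X *\<^sub>v x = s \<cdot>\<^sub>v (K *\<^sub>v (X *\<^sub>v x))"
      using add_mult_distrib_mat_vec[OF c(4,5) x(1)] 1 2 P(2) c(6) by (simp add: P(1,4))
    then show ?thesis using 3 P(2) c(6) x(1) by (simp add: braket_def mult.assoc)
  qed
  \<comment> \<open>\<open>K\<close> is \<open>s\<close> along \<open>x\<close> and 1 on the
    orthogonal complement, so its inverse adds (1/s - 1)|x><x| to the identity.\<close>
  obtain K' where K': "K' \<in> carrier_mat n n" "K' * K = 1\<^sub>m n" "K * K' = 1\<^sub>m n"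
  proof
    show "1\<^sub>m n + ((1 - s) / s) \<cdot>\<^sub>m outer x x \<in> carrier_mat n n" using x by simp
    have O: "outer x x \<in> carrier_mat n n" "outer x x * outer x x = outer x x"
      using x by (simp_all add: mat_mult_outer[of _ n n _ _ n] outer_mult_vec[of _ n _ n])
    have Kd: "K = 1\<^sub>m n - (1 - s) \<cdot>\<^sub>m outer x x" by (simp add: K_def s_def)
    have "outer x x * K = outer x x - (1 - s) \<cdot>\<^sub>m outer x x"
      unfolding Kd mult_minus_distrib_mat[OF O(1) one_carrier_mat smult_carrier_mat[OF O(1)]]
      using O by (simp add: mult_smult_distrib[OF O(1) O(1)] right_mult_one_mat[OF O(1)])
    also have "\<dots> = s \<cdot>\<^sub>m outer x x"
      by (rule eq_matI) (auto simp: algebra_simps)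
    finally have OK: "outer x x * K = s \<cdot>\<^sub>m outer x x" .
    have "(1\<^sub>m n + ((1 - s) / s) \<cdot>\<^sub>m outer x x) * K = K + ((1 - s) / s) \<cdot>\<^sub>m (s \<cdot>\<^sub>m outer x x)"
      unfolding add_mult_distrib_mat[OF one_carrier_mat smult_carrier_mat[OF O(1)] P(2)]
      using P(2) by (simp add: mult_smult_assoc_mat[OF O(1) P(2)] OK)
    also have "\<dots> = 1\<^sub>m n"
      using s x by (intro eq_matI) (auto simp: Kd)
    finally show inv: "(1\<^sub>m n + ((1 - s) / s) \<cdot>\<^sub>m outer x x) * K = 1\<^sub>m n" .
    then show "K * (1\<^sub>m n + ((1 - s) / s) \<cdot>\<^sub>m outer x x) = 1\<^sub>m n"
      using O by (intro mat_mult_left_right_inverse[OF _ P(2) inv]) auto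
  qed
  fix X Y assume XY: "X \<in> carrier_mat n n" "Y \<in> carrier_mat n n" and eq: "Psi n l x y X = Psi n l x y Y"
  have "braket x (X *\<^sub>v x) = braket x (Y *\<^sub>v x)"
    using diag[OF XY(1)] diag[OF XY(2)] eq s by simp
  then have "L * X * mat_adjoint L = L * Y * mat_adjoint L"
    using LX XY by simp
  then have sum: "K * X * K + L * Y * mat_adjoint L = K * Y * K + L * Y * mat_adjoint L"
    using eq by (simp add: P(1,4))
  have "K * X * K \<in> carrier_mat n n" "K * Y * K \<in> carrier_mat n n"
    "L * Y * mat_adjoint L \<in> carrier_mat n n"
    using P(2,3) XY by (auto intro!: mult_carrier_mat[of _ n n])
  then have KXK: "K * X * K = K * Y * K"
    by (rule add_right_imp_eq_mat[OF sum])
  have rec: "K' * (K * Z * K) * K' = Z" if Z: "Z \<in> carrier_mat n n" for Z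
  proof -
    have KZ: "K * Z \<in> carrier_mat n n" using P(2) Z by (rule mult_carrier_mat)
    have "K' * (K * Z * K) * K' = K' * (K * Z * K * K')"
      by (rule assoc_mult_mat[OF K'(1) mult_carrier_mat[OF KZ P(2)] K'(1)])
    also have "K * Z * K * K' = K * Z"
      unfolding assoc_mult_mat[OF KZ P(2) K'(1)] K'(3) by (rule right_mult_one_mat[OF KZ])
    also have "K' * (K * Z) = K' * K * Z"
      by (rule assoc_mult_mat[OF K'(1) P(2) Z, symmetric])
    also have "\<dots> = Z" unfolding K'(2) by (rule left_mult_one_mat[OF Z])
    finally show ?thesis .
  qed
  have "X = K' * (K * X * K) * K'" by (rule rec[OF XY(1), symmetric])
  also have "\<dots> = Y" unfolding KXK by (rule rec[OF XY(2)])
  finally show "X = Y" .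
qed

lemma completely_positive_comp_inv_Psi_imp:
  assumes \<Phi>: "linear_on_mats n \<Phi>" and kr: "kraus_operators n \<Phi> Ks0"
    and x: "x \<in> carrier_vec n" "braket x x = 1" and y: "y \<in> carrier_vec n" "braket x y = 0"
    and l: "0 < l" "l < 1"
    and cp: "completely_positive n (\<Phi> \<circ> inv_into (carrier_mat n n) (Psi n l x y))"
  shows "channel_condition n \<Phi> x y"
proof -
  define \<Lambda> where "\<Lambda> = \<Phi> \<circ> inv_into (carrier_mat n n) (Psi n l x y)"
  define K where "K = 1\<^sub>m n - complex_of_real (1 - sqrt (1 - l)) \<cdot>\<^sub>m outer x x"
  define L where "L = complex_of_real (sqrt l) \<cdot>\<^sub>m outer y x"
  note P = Psi_kraus[OF x y, of l, folded K_def L_def]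
  have lin: "linear_on_mats n \<Lambda>" using cp by (simp add: completely_positive_def \<Lambda>_def)
  obtain Ms where Ms: "kraus_operators n \<Lambda> Ms"
    using kraus_operators_exist[OF cp] by (auto simp: \<Lambda>_def)
  have "\<Phi> X = \<Lambda> (K * X * mat_adjoint K + L * X * mat_adjoint L)" if "X \<in> carrier_mat n n" for X
    \<comment> \<open>Injectivity cancels the inverse, so \<Phi> is \<Lambda> after
      \<open>Psi\<close> on n x n matrices.\<close>
    using inv_into_f_f[OF inj_on_Psi[OF l(2) x y] that] by (simp add: \<Lambda>_def P(1)[symmetric])
  then have Ks: "kraus_operators n \<Phi> (map (\<lambda>M. M * K) Ms @ map (\<lambda>M. M * L) Ms)"
    by (intro kraus_operators_comp[OF lin Ms \<Phi> P(2,3)])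
  show ?thesis
    unfolding channel_condition_iff[OF Ks x(1) y(1)]
  proof (intro ballI)
    fix N G assume N: "N \<in> set (map (\<lambda>M. M * K) Ms @ map (\<lambda>M. M * L) Ms)" and G: "G \<in> kraus_perp n \<Phi>"
    then have Gc: "G \<in> carrier_mat n n" by (simp add: kraus_perp_def)
    obtain M where M: "M \<in> set Ms" "N = M * K \<or> N = M * L" using N by auto
    have Mc: "M \<in> carrier_mat n n" using M Ms by (auto simp: kraus_operators_def)
    have Nc: "N \<in> carrier_mat n n" using M(2) Mc P(2,3) by (auto intro: mult_carrier_mat)
    have "mat_trace (mat_adjoint (M * L) * G) = 0"
      using G M(1) Ks orthogonal_kraus_operators_iff[OF \<Phi> Ks Gc] mem_kraus_perp_iff[OF \<Phi>] by auto
    \<comment> \<open>As \<open>L\<close> has rank one, orthogonality of \<open>G\<close> to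
      \<open>M * L\<close> is a single bracket with G|x>.\<close>
    moreover have "M * L = outer (complex_of_real (sqrt l) \<cdot>\<^sub>v (M *\<^sub>v y)) x"
      using Mc x y by (simp add: L_def mult_smult_distrib[of _ n n _ n] mat_mult_outer[of _ n n _ _ n])
        (auto intro!: eq_matI)
    ultimately have "braket (complex_of_real (sqrt l) \<cdot>\<^sub>v (M *\<^sub>v y)) (G *\<^sub>v x) = 0"
      using Mc Gc x y mat_trace_adjoint_outer_mult[of "complex_of_real (sqrt l) \<cdot>\<^sub>v (M *\<^sub>v y)" n x G]
      by simp
    \<comment> \<open>Since 0 < l, the factor \<open>sqrt l\<close> can be cancelled.\<close>
    then have K0: "braket (M *\<^sub>v y) (G *\<^sub>v x) = 0"
      using Mc Gc x y l by (simp add: braket_def conjugate_smult_vec)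
    \<comment> \<open>The first alternative belongs to \<open>M * K\<close>, since \<open>K\<close>
      fixes \<open>y\<close>; the second to \<open>M * L\<close>, since \<open>L\<close> kills
      \<open>y\<close>.\<close>
    have "N *\<^sub>v y = M *\<^sub>v y \<or> N *\<^sub>v y = 0\<^sub>v n"
      using M(2) assoc_mult_mat_vec[OF Mc P(2) y(1)] assoc_mult_mat_vec[OF Mc P(3) y(1)] Mc P(6,7)
      by (auto simp: scalar_prod_def intro!: eq_vecI)
    then show "braket y ((mat_adjoint N * G) *\<^sub>v x) = 0"
      using K0 Nc Gc x y by (auto simp: braket_adjoint_mult[of _ n]) (simp add: braket_def)
  qed
qed

theorem proposition1:
  fixes n :: nat
    and \<Phi> :: "complex mat \<Rightarrow> complex mat"
    and x x' :: "complex vec"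
  assumes "\<Phi> \<in> CPTP n"
    and "x \<in> carrier_vec n" and "x' \<in> carrier_vec n"
    and "braket x x = 1" and "braket x' x' = 1" and "braket x x' = 0"
  shows "((\<forall>\<iota>. kernel_unitary n \<Phi> \<iota> \<longrightarrow> choi_condition n \<Phi> x x' \<iota>) \<longleftrightarrow> channel_condition n \<Phi> x x') \<and>
    ((\<exists>\<iota>. kernel_unitary n \<Phi> \<iota> \<and> choi_condition n \<Phi> x x' \<iota>) \<longleftrightarrow> channel_condition n \<Phi> x x') \<and>
    (channel_condition n \<Phi> x x' \<longleftrightarrow> kraus_condition n \<Phi> x x') \<and>
    ((\<exists>l::real. 0 < l \<and> l < 1 \<and>
        completely_positive n (\<Phi> \<circ> inv_into (carrier_mat n n) (Psi n l x x'))) \<longrightarrow>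
      (\<forall>\<iota>. kernel_unitary n \<Phi> \<iota> \<longrightarrow> choi_condition n \<Phi> x x' \<iota>) \<and>
      channel_condition n \<Phi> x x' \<and> kraus_condition n \<Phi> x x')"
proof -
  have cp: "completely_positive n \<Phi>" using assms(1) by (simp add: CPTP_def)
  then have lin: "linear_on_mats n \<Phi>" by (simp add: completely_positive_def)
  obtain Ks where kr: "kraus_operators n \<Phi> Ks" using kraus_operators_exist[OF cp] by blast
  obtain \<iota> where \<iota>: "kernel_unitary n \<Phi> \<iota>" using kernel_unitary_exists[OF lin] by blast
  have choi: "choi_condition n \<Phi> x x' \<iota> \<longleftrightarrow> channel_condition n \<Phi> x x'"
    if "kernel_unitary n \<Phi> \<iota>" for \<iota>
    using choi_condition_iff[OF lin kr assms(2,3) that] channel_condition_iff[OF kr assms(2,3)] by simp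
  have kraus: "kraus_condition n \<Phi> x x' \<longleftrightarrow> channel_condition n \<Phi> x x'"
    using kraus_condition_iff[OF lin kr assms(2,3)] channel_condition_iff[OF kr assms(2,3)] by simp
  have "channel_condition n \<Phi> x x'"
    if "0 < l" "l < 1" "completely_positive n (\<Phi> \<circ> inv_into (carrier_mat n n) (Psi n l x x'))" for l
    using completely_positive_comp_inv_Psi_imp[OF lin kr assms(2,4,3,6) that] .
  then have Psi: "(\<exists>l::real. 0 < l \<and> l < 1 \<and>
      completely_positive n (\<Phi> \<circ> inv_into (carrier_mat n n) (Psi n l x x'))) \<longrightarrow> channel_condition n \<Phi> x x'"
    by blast
  \<comment> \<open>Each \<iota> gives the same criterion and at least one exists, so both
    quantified forms of (i) reduce to (ii).\<close>
  have all: "(\<forall>\<iota>. kernel_unitary n \<Phi> \<iota> \<longrightarrow> choi_condition n \<Phi> x x' \<iota>) \<longleftrightarrow> channel_condition n \<Phi> x x'"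
    using \<iota> choi by blast
  have ex: "(\<exists>\<iota>. kernel_unitary n \<Phi> \<iota> \<and> choi_condition n \<Phi> x x' \<iota>) \<longleftrightarrow> channel_condition n \<Phi> x x'"
    using \<iota> choi by blast
  show ?thesis unfolding all ex kraus using Psi by simp
qed

end
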